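(* Let $r\geq 2$, $t\geq 2$ with $t\mid n$, and $\alpha\in(0,1/2]$ with $\alpha n/t$ an integer. Any one-way classical protocol (one classical message from Alice to Bob) that achieves advantage $\varepsilon>0$ for the $r$-ary Hidden Hypermatching problem $r\text{-}\mathsf{HH}(\alpha,t,n)$ requires at least $\Omega\big(r^{-1}(\varepsilon^4/\alpha)^{1/t}(n/t)^{1-1/t}\big)$ bits of communication.
   Context: An $\alpha$-partial $t$-hypermatching on $[n]$ is a sequence of $\alpha n/t$ pairwise disjoint hyperedges, each consisting of $t$ distinct elements of $[n]$; its incidence matrix $M\in\{0,1\}^{\alpha n/t\times n}$ has row $i$ equal to the indicator of the $i$-th hyperedge. In $r\text{-}\mathsf{HH}(\alpha,t,n)$, Alice gets $x\in\mathbb{Z}_r^n$, Bob gets an $\alpha$-partial $t$-hypermatching $M$ and $w\in\mathbb{Z}_r^{\alpha n/t}$; under the YES distribution $w=Mx$ (over $\mathbb{Z}_r$), under the NO distribution $w$ is uniform in $\mathbb{Z}_r^{\alpha n/t}$. Bob must decide, after one message from Alice, which distribution $w$ came from; advantage $\varepsilon$ means success probability at least $1/2+\varepsilon$. *)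

theory Defs
  imports "HOL-Probability.Probability"
begin

text \<open>
  The index set $[n]$ is \<open>{..<n}\<close>. A vector over $\mathbb{Z}_r$ of length \<open>n\<close> is an extensional
  function on \<open>{..<n}\<close> whose values are the canonical residues \<open>{..<r}\<close>; arithmetic is modulo \<open>r\<close>.
\<close>

definition Zr_vec :: "nat \<Rightarrow> nat \<Rightarrow> (nat \<Rightarrow> nat) set" where
  "Zr_vec r n = {..<n} \<rightarrow>\<^sub>E {..<r}"

text \<open>
  Because the length of the sequence is compared with $\alpha n / t$ over the reals, there is no
  hypermatching unless that number is a natural number.
\<close>

definition hypermatchings :: "real \<Rightarrow> nat \<Rightarrow> nat \<Rightarrow> nat set list set" where
  "hypermatchings \<alpha> t n =
     {M. real (length M) = \<alpha> * real n / real t \<and>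
         (\<forall>i<length M. M ! i \<subseteq> {..<n} \<and> card (M ! i) = t) \<and>
         (\<forall>i<length M. \<forall>j<length M. i \<noteq> j \<longrightarrow> M ! i \<inter> M ! j = {})}"

definition incidence :: "nat set list \<Rightarrow> nat \<Rightarrow> nat \<Rightarrow> nat" where
  "incidence M i j = (if j \<in> M ! i then 1 else 0)"

definition mult_vec :: "nat \<Rightarrow> nat \<Rightarrow> nat set list \<Rightarrow> (nat \<Rightarrow> nat) \<Rightarrow> (nat \<Rightarrow> nat)" where
  "mult_vec r n M x = (\<lambda>i\<in>{..<length M}. (\<Sum>j<n. incidence M i j * x j) mod r)"

definition yes_dist :: "nat \<Rightarrow> nat \<Rightarrow> nat set list \<Rightarrow> (nat \<Rightarrow> nat) \<Rightarrow> (nat \<Rightarrow> nat) pmf" where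
  "yes_dist r n M x = return_pmf (mult_vec r n M x)"

definition no_dist :: "nat \<Rightarrow> nat set list \<Rightarrow> (nat \<Rightarrow> nat) pmf" where
  "no_dist r M = pmf_of_set (Zr_vec r (length M))"

text \<open>
  A deterministic one-way protocol consists of Alice's message, a function of \<open>x\<close>, and Bob's
  answer, a function of the message, \<open>M\<close> and \<open>w\<close>; the answer \<open>True\<close> stands for YES.
  A randomized protocol is a probability distribution on deterministic ones (shared randomness);
  private coins are the case where the two components are independent. Restricted to
  the finitely many inputs and messages of bounded length there are only finitely many
  deterministic protocols, so discrete distributions lose no generality.
\<close>

type_synonym det_protocol =
  "((nat \<Rightarrow> nat) \<Rightarrow> bool list) \<times> (bool list \<Rightarrow> nat set list \<Rightarrow> (nat \<Rightarrow> nat) \<Rightarrow> bool)"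

type_synonym protocol = "det_protocol pmf"

definition comm_at_most :: "protocol \<Rightarrow> nat \<Rightarrow> nat \<Rightarrow> nat \<Rightarrow> bool" where
  "comm_at_most P r n C \<longleftrightarrow>
     (\<forall>(alice, bob)\<in>set_pmf P. \<forall>x\<in>Zr_vec r n. length (alice x) \<le> C)"

text \<open>
  The hidden bit \<open>b\<close> is a fair coin: \<open>w\<close> comes from the YES distribution if \<open>b\<close> and from the NO
  distribution otherwise. The probability is over \<open>b\<close>, \<open>w\<close> and the coins of the protocol, for
  fixed \<open>x\<close> and \<open>M\<close>.
\<close>

definition success_prob ::
  "protocol \<Rightarrow> nat \<Rightarrow> nat \<Rightarrow> nat set list \<Rightarrow> (nat \<Rightarrow> nat) \<Rightarrow> real" where
  "success_prob P r n M x = measure_pmf.prob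
     (bind_pmf P (\<lambda>(alice, bob).
        bind_pmf (bernoulli_pmf (1/2)) (\<lambda>b.
          bind_pmf (if b then yes_dist r n M x else no_dist r M) (\<lambda>w.
            return_pmf (bob (alice x) M w = b)))))
     {True}"

text \<open>The success guarantee is required on every input \<open>x\<close> and \<open>M\<close>.\<close>

definition achieves_advantage ::
  "protocol \<Rightarrow> nat \<Rightarrow> real \<Rightarrow> nat \<Rightarrow> nat \<Rightarrow> real \<Rightarrow> bool" where
  "achieves_advantage P r \<alpha> t n \<epsilon> \<longleftrightarrow>
     (\<forall>x\<in>Zr_vec r n. \<forall>M\<in>hypermatchings \<alpha> t n. success_prob P r n M x \<ge> 1/2 + \<epsilon>)"

end

theory Submission
  imports Defs
begin

text \<open>
  Let $A$ be the set of inputs that lead to a given message and $\mu$ its density. By Parseval, the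
  squared bias of $Mx$ for uniform $x \in A$ is $\mu^{-2} \sum_{s \neq 0} |\hat 1_A(M^T s)|^2$, and
  $M^T s$ has support size $tk$ when $s$ has support size $k$. Averaging over a random hypermatching
  spreads these frequencies evenly over all supports of size $tk$, which gives
  $\mu^{-2} \sum_k \binom mk \binom n{tk}^{-1} W_{tk}$, where $W_j$ is the Fourier weight of $1_A$ at
  level $j$. Hypercontractivity on $\mathbb{Z}_r^n$ with noise parameter $\delta / (2r)$ for exponents
  $1 + \delta$ and $2$ bounds $W_{tk}$ for $k$ up to about $\ln(1/\mu)/t$; beyond that,
  Parseval and the monotonicity of the binomial ratio suffice. Messages of density below
  $\varepsilon / 2^{C+1}$ contribute at most $\varepsilon$ in total, and
  the resulting term $\ln(1/\varepsilon)$ is absorbed by having $\varepsilon^4$ instead of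
  $\varepsilon^2$ in the bound.
\<close>

section \<open>Hypercontractivity\<close>

text \<open>The noise rate comes from a single coordinate. A nonnegative function of mean 1 on
  \<open>r\<close> points is at most \<open>r\<close>, and on that range
  \<open>y ln y - y + 1\<close> dominates \<open>(y - 1)^2 / (2 r)\<close>; this is the origin of
  the factor \<open>1 / r\<close> in the theorem. The exponent must be tuned to the level. If
  \<open>exp (- t R)\<close> bounds the density from below, then \<delta> = \<open>k / R\<close>
  costs a constant per coordinate of a support of size \<open>t k\<close>, and the \<open>k\<close>
  in \<delta> cancels the \<open>k\<close> of the binomial ratio, so the levels form a geometric
  series. As \<delta> \<le> 1 is required, this ends at \<open>k = R\<close>. Past that point
  Parseval gives one factor of the density where two are wanted; the missing factor is at least
  \<open>exp (- t k)\<close>, and the binomial ratio pays for it. The binomial ratio is monotone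
  because \<alpha> \<le> 1/2 keeps all levels in the increasing half of the binomial coefficients.
  The extra \<epsilon>^2 under the \<open>t\<close>-th root is spent on enlarging \<open>R\<close>
  beyond the communication, to make room for the light messages.\<close>

lemma quadratic_le_entropy:
  fixes y r :: real
  assumes "0 < y" "y \<le> r" "1 \<le> r"
  shows "(y - 1)\<^sup>2 / (2 * r) \<le> y * ln y - y + 1"
proof -
  define f where "f = (\<lambda>y::real. y * ln y - y + 1 - (y - 1)\<^sup>2 / (2 * r))"
  \<comment> \<open>On \<open>(0, r]\<close> the derivative has the sign of \<open>z - 1\<close>, so
    the minimum is at 1. Above 1 this is \<open>ln z \<ge> 1 - 1/z \<ge> (z - 1) / r\<close>, which
    needs \<open>z \<le> r\<close>; below 1 it is \<open>ln z \<le> z - 1 \<le> (z - 1) / r\<close>,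
    which needs \<open>r \<ge> 1\<close>.\<close>
  have deriv: "(f has_real_derivative ln z - (z - 1) / r) (at z)" if "0 < z" for z
    unfolding f_def using that assms
    by (auto intro!: derivative_eq_intros simp: field_simps)
  have f1: "f 1 = 0"
    by (simp add: f_def)
  have "0 \<le> f y"
  proof (cases "1 \<le> y")
    case True
    have "f 1 \<le> f y"
    proof (rule DERIV_nonneg_imp_nondecreasing[OF True])
      fix z assume z: "1 \<le> z" "z \<le> y"
      have "1 - inverse z \<le> ln z"
        using ln_le_minus_one[of "inverse z"] z by (simp add: ln_inverse)
      moreover have "(z - 1) / r \<le> (z - 1) / z"
        using z assms by (intro divide_left_mono) auto
      moreover have "(z - 1) / z = 1 - inverse z"
        using z by (simp add: field_simps)
      ultimately have "0 \<le> ln z - (z - 1) / r"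
        by linarith
      then show "\<exists>d. DERIV f z :> d \<and> 0 \<le> d"
        using deriv[of z] z by force
    qed
    then show ?thesis using f1 by simp
  next
    case False
    have "f 1 \<le> f y"
    proof (rule DERIV_nonpos_imp_nonincreasing[of y 1])
      fix z assume z: "y \<le> z" "z \<le> 1"
      have "ln z \<le> z - 1"
        using ln_le_minus_one[of z] z assms by simp
      moreover have "(1 - z) / r \<le> (1 - z) / 1"
        using z assms by (intro divide_left_mono) auto
      ultimately have "ln z - (z - 1) / r \<le> 0"
        by (simp add: diff_divide_distrib)
      then show "\<exists>d. DERIV f z :> d \<and> d \<le> 0"
        using deriv[of z] z assms by force
    qed (use False in auto)
    then show ?thesis using f1 by simp
  qed
  then show ?thesis
    by (simp add: f_def)
qed

text \<open>Linearise the exponential in \<open>y * exp (\<delta> * ln y)\<close>; the entropy bound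
  then supplies the quadratic term. The linear term is kept apart because it cancels when averaged
  over values of mean 1.\<close>

lemma powr_ge_quadratic:
  fixes y r \<delta> :: real
  assumes "0 \<le> y" "y \<le> r" "1 \<le> r" "0 < \<delta>"
  shows "1 + (1 + \<delta>) * (y - 1) + \<delta> / (2 * r) * (y - 1)\<^sup>2 \<le> y powr (1 + \<delta>)"
proof (cases "y = 0")
  case True
  have "\<delta> / (2 * r) \<le> \<delta> / 1"
    using assms by (intro divide_left_mono) auto
  with True show ?thesis by simp
next
  case False
  then have y: "0 < y" using assms by simp
  have "1 + \<delta> * ln y \<le> y powr \<delta>"
    using exp_ge_add_one_self[of "\<delta> * ln y"] y by (simp add: powr_def)
  then have "y * (1 + \<delta> * ln y) \<le> y * y powr \<delta>"
    using y by (intro mult_left_mono) auto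
  moreover have "y powr (1 + \<delta>) = y * y powr \<delta>"
    using y by (simp add: powr_add)
  moreover have "\<delta> * ((y - 1)\<^sup>2 / (2 * r)) \<le> \<delta> * (y * ln y - y + 1)"
    using quadratic_le_entropy[OF y] assms by (intro mult_left_mono) auto
  ultimately show ?thesis
    by (simp add: algebra_simps)
qed

text \<open>Both sides are homogeneous of degree 2, so the mean can be scaled to 1. Nonnegative
  values with sum \<open>r\<close> lie in \<open>[0, r]\<close>, which is the range of the pointwise
  bound. The left side is the noisy second moment along one coordinate.\<close>

lemma one_variable_hypercontractive:
  fixes N :: "nat \<Rightarrow> real" and \<delta> :: real
  assumes r: "0 < r" and N: "\<And>a. a < r \<Longrightarrow> 0 \<le> N a" and \<delta>: "0 < \<delta>" "\<delta> \<le> 1"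
  defines "\<kappa> \<equiv> \<delta> / (2 * real r)"
  shows "\<kappa> * ((\<Sum>a<r. (N a)\<^sup>2) / r) + (1 - \<kappa>) * ((\<Sum>a<r. N a) / r)\<^sup>2
           \<le> ((\<Sum>a<r. N a powr (1 + \<delta>)) / r) powr (2 / (1 + \<delta>))"
proof (cases "(\<Sum>a<r. N a) = 0")
  case True
  then have "N a = 0" if "a < r" for a
    using sum_nonneg_eq_0_iff[of "{..<r}" N] N that by auto
  then show ?thesis by simp
next
  case False
  define A where "A = (\<Sum>a<r. N a) / r"
  have "0 \<le> (\<Sum>a<r. N a)" using N by (intro sum_nonneg) auto
  with False r have A: "0 < A" by (simp add: A_def)
  define y where "y = (\<lambda>a. N a / A)"
  have sumN: "(\<Sum>a<r. N a) = r * A" using r by (simp add: A_def)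
  have sumy: "(\<Sum>a<r. y a) = r"
    using A by (simp add: y_def sum_divide_distrib[symmetric] sumN)
  have y0: "0 \<le> y a" if "a < r" for a
    using that N A by (simp add: y_def)
  have yr: "y a \<le> r" if "a < r" for a
    using member_le_sum[of a "{..<r}" y] that y0 sumy by simp
  define Z where "Z = (\<Sum>a<r. y a powr (1 + \<delta>)) / r"
  define V where "V = (\<Sum>a<r. (y a)\<^sup>2) / r"
  have "(\<Sum>a<r. 1 + (1 + \<delta>) * (y a - 1) + \<kappa> * (y a - 1)\<^sup>2) \<le> (\<Sum>a<r. y a powr (1 + \<delta>))"
    unfolding \<kappa>_def using y0 yr r \<delta> by (intro sum_mono powr_ge_quadratic) auto
  also have "(\<Sum>a<r. 1 + (1 + \<delta>) * (y a - 1) + \<kappa> * (y a - 1)\<^sup>2)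
    = r + (1 + \<delta>) * ((\<Sum>a<r. y a) - r) + \<kappa> * ((\<Sum>a<r. (y a)\<^sup>2) - 2 * (\<Sum>a<r. y a) + r)"
    by (simp add: sum.distrib sum_distrib_left[symmetric] sum_subtractf power2_diff)
  also have "\<dots> = r * (1 + \<kappa> * (V - 1))"
    using r unfolding sumy by (simp add: V_def field_simps)
  finally have Z: "1 + \<kappa> * (V - 1) \<le> Z"
    using r by (simp add: Z_def field_simps)
  have "0 \<le> (\<Sum>a<r. (y a - 1)\<^sup>2)" by (simp add: sum_nonneg)
  also have "\<dots> = (\<Sum>a<r. (y a)\<^sup>2) - 2 * (\<Sum>a<r. y a) + r"
    by (simp add: sum.distrib sum_distrib_left[symmetric] sum_subtractf power2_diff)
  finally have "1 \<le> V" using r unfolding sumy by (simp add: V_def field_simps)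
  moreover have "0 < \<kappa>" using \<delta> r by (simp add: \<kappa>_def)
  ultimately have Z1: "1 \<le> Z" using Z by (smt (verit) mult_nonneg_nonneg)
  \<comment> \<open>The exponent \<open>2 / (1 + \<delta>)\<close> is at least 1 because \<delta>
    \<le> 1, so it can only enlarge a base \<open>Z \<ge> 1\<close>.\<close>
  have "Z powr 1 \<le> Z powr (2 / (1 + \<delta>))"
    using Z1 \<delta> by (intro powr_mono) auto
  then have ineq: "1 + \<kappa> * (V - 1) \<le> Z powr (2 / (1 + \<delta>))"
    using Z Z1 by simp
  have NA: "N a = A * y a" for a using A by (simp add: y_def)
  have "(\<Sum>a<r. N a powr (1 + \<delta>)) = (\<Sum>a<r. A powr (1 + \<delta>) * y a powr (1 + \<delta>))"
    using A y0 by (intro sum.cong) (auto simp: NA powr_mult)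
  then have "((\<Sum>a<r. N a powr (1 + \<delta>)) / r) powr (2 / (1 + \<delta>))
     = (A powr (1 + \<delta>) * Z) powr (2 / (1 + \<delta>))"
    by (simp add: Z_def sum_distrib_left[symmetric])
  also have "\<dots> = A\<^sup>2 * Z powr (2 / (1 + \<delta>))"
  proof -
    have "(1 + \<delta>) * (2 / (1 + \<delta>)) = 2" using \<delta> by (simp add: divide_eq_eq)
    then show ?thesis
      using A Z1 by (simp only: powr_mult powr_powr powr_numeral)
  qed
  finally have rhs: "((\<Sum>a<r. N a powr (1 + \<delta>)) / r) powr (2 / (1 + \<delta>)) = A\<^sup>2 * Z powr (2 / (1 + \<delta>))" .
  have "(\<Sum>a<r. (N a)\<^sup>2) / r = A\<^sup>2 * V"
    by (simp add: NA power_mult_distrib V_def sum_distrib_left[symmetric])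
  then have "\<kappa> * ((\<Sum>a<r. (N a)\<^sup>2) / r) + (1 - \<kappa>) * ((\<Sum>a<r. N a) / r)\<^sup>2 = A\<^sup>2 * (1 + \<kappa> * (V - 1))"
    using r by (simp add: sumN algebra_simps)
  with ineq A show ?thesis
    unfolding rhs by simp
qed

lemma sum_PiE_insert:
  fixes F :: "('i \<Rightarrow> 'b) \<Rightarrow> 'c::comm_monoid_add"
  assumes "i \<notin> I"
  shows "(\<Sum>x\<in>insert i I \<rightarrow>\<^sub>E Y. F x) = (\<Sum>a\<in>Y. \<Sum>x\<in>I \<rightarrow>\<^sub>E Y. F (x(i := a)))"
proof -
  have "(\<Sum>x\<in>insert i I \<rightarrow>\<^sub>E Y. F x) = (\<Sum>(a, x)\<in>Y \<times> (I \<rightarrow>\<^sub>E Y). F (x(i := a)))"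
    unfolding PiE_insert_eq using inj_combinator[OF assms, of "\<lambda>_. Y"]
    by (subst sum.reindex) (auto simp: case_prod_unfold)
  then show ?thesis
    by (simp add: sum.cartesian_product)
qed

section \<open>Characters and the Fourier transform over Z_r\<close>

definition zeta :: "nat \<Rightarrow> complex" where
  "zeta r = cis (2 * pi / real r)"

lemma zeta_power: "zeta r ^ k = cis (2 * pi * real k / real r)"
  unfolding zeta_def Complex.DeMoivre by (rule arg_cong[where f = cis]) simp

lemma zeta_power_r: "0 < r \<Longrightarrow> zeta r ^ r = 1"
  by (simp add: zeta_power)

lemma norm_zeta_power: "cmod (zeta r ^ k) = 1"
  by (simp add: zeta_power)

lemma zeta_power_mod:
  assumes "0 < r"
  shows "zeta r ^ (k mod r) = zeta r ^ k"
proof -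
  have "zeta r ^ k = zeta r ^ (r * (k div r) + k mod r)"
    by simp
  also have "\<dots> = zeta r ^ (k mod r)"
    using assms by (simp only: power_add power_mult zeta_power_r power_one mult_1)
  finally show ?thesis ..
qed

lemma zeta_power_inj:
  assumes "0 < r" "b < r" "c < r" "zeta r ^ b = zeta r ^ c"
  shows "b = c"
  using bij_betw_imp_inj_on[OF Complex.bij_betw_roots_unity[OF assms(1)]] assms(2-)
  by (auto simp: zeta_power inj_on_def)

lemma zeta_orthogonal:
  assumes "b < r" "c < r"
  shows "(\<Sum>a<r. zeta r ^ (a * b) * cnj (zeta r ^ (a * c))) = (if b = c then of_nat r else 0)"
proof -
  have r: "0 < r" using assms by simp
  define z where "z = zeta r ^ b * cnj (zeta r ^ c)"
  have unit: "zeta r ^ c * cnj (zeta r ^ c) = 1"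
    unfolding complex_norm_square[symmetric] norm_zeta_power by simp
  have "(\<Sum>a<r. zeta r ^ (a * b) * cnj (zeta r ^ (a * c))) = (\<Sum>a<r. z ^ a)"
    by (intro sum.cong) (auto simp: z_def power_mult_distrib power_mult[symmetric] mult.commute)
  moreover have "(\<Sum>a<r. z ^ a) = 0" if "b \<noteq> c"
  proof -
    have "z ^ r = (zeta r ^ r) ^ b * cnj ((zeta r ^ r) ^ c)"
      by (simp add: z_def power_mult_distrib power_mult[symmetric] mult.commute)
    then have "z ^ r = 1" using r by (simp add: zeta_power_r)
    moreover have "z \<noteq> 1"
    proof
      assume "z = 1"
      have "zeta r ^ b = zeta r ^ b * (zeta r ^ c * cnj (zeta r ^ c))"
        by (simp only: unit mult_1_right)
      also have "\<dots> = z * zeta r ^ c"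
        by (simp only: z_def mult_ac)
      finally show False using zeta_power_inj[OF r assms] that \<open>z = 1\<close> by simp
    qed
    ultimately show ?thesis by (simp add: geometric_sum)
  qed
  moreover have "z = 1" if "b = c" using that unit by (simp add: z_def)
  ultimately show ?thesis by auto
qed

lemma parseval_one:
  fixes g :: "nat \<Rightarrow> complex"
  shows "(\<Sum>a<r. (cmod (\<Sum>b<r. zeta r ^ (a * b) * g b))\<^sup>2) = r * (\<Sum>b<r. (cmod (g b))\<^sup>2)"
proof -
  have "complex_of_real (\<Sum>a<r. (cmod (\<Sum>b<r. zeta r ^ (a * b) * g b))\<^sup>2)
     = (\<Sum>a<r. \<Sum>b<r. \<Sum>c<r. g b * cnj (g c) * (zeta r ^ (a * b) * cnj (zeta r ^ (a * c))))"
    by (simp only: of_real_sum complex_norm_square cnj_sum sum_product)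
      (intro sum.cong refl; simp add: mult_ac)
  also have "\<dots> = (\<Sum>b<r. \<Sum>c<r. g b * cnj (g c) * (\<Sum>a<r. zeta r ^ (a * b) * cnj (zeta r ^ (a * c))))"
    unfolding sum_distrib_left
    by (rule trans[OF sum.swap], rule sum.cong[OF refl], rule sum.swap)
  also have "\<dots> = (\<Sum>b<r. \<Sum>c<r. if b = c then of_nat r * (g b * cnj (g c)) else 0)"
    by (intro sum.cong refl) (simp add: zeta_orthogonal del: complex_cnj_power)
  also have "\<dots> = of_nat r * (\<Sum>b<r. g b * cnj (g b))"
    by (simp add: sum_distrib_left)
  also have "\<dots> = complex_of_real (r * (\<Sum>b<r. (cmod (g b))\<^sup>2))"
    by (simp add: complex_norm_square del: of_real_power)
  finally show ?thesis
    by (simp only: of_real_eq_iff)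
qed

definition character :: "nat \<Rightarrow> 'i set \<Rightarrow> ('i \<Rightarrow> nat) \<Rightarrow> ('i \<Rightarrow> nat) \<Rightarrow> complex" where
  "character r I v x = (\<Prod>i\<in>I. zeta r ^ (v i * x i))"

text \<open>With this normalisation the zero frequency is the mean and Parseval has no extra factor.
  The character is not conjugated, so this is the usual coefficient at \<open>-v\<close>, which has
  the same support as \<open>v\<close>.\<close>

definition fourier :: "nat \<Rightarrow> 'i set \<Rightarrow> (('i \<Rightarrow> nat) \<Rightarrow> real) \<Rightarrow> ('i \<Rightarrow> nat) \<Rightarrow> complex" where
  "fourier r I f v = (\<Sum>x\<in>I \<rightarrow>\<^sub>E {..<r}. f x * character r I v x) / of_nat (r ^ card I)"

definition support :: "'i set \<Rightarrow> ('i \<Rightarrow> nat) \<Rightarrow> 'i set" where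
  "support I v = {i \<in> I. v i \<noteq> 0}"

text \<open>For \<kappa> \<ge> 0 this is the squared 2-norm of \<open>f\<close> after the noise
  operator with parameter \<open>sqrt \<kappa>\<close>, written on the Fourier side.\<close>

definition noisy_weight :: "real \<Rightarrow> nat \<Rightarrow> 'i set \<Rightarrow> (('i \<Rightarrow> nat) \<Rightarrow> real) \<Rightarrow> real" where
  "noisy_weight \<kappa> r I f =
     (\<Sum>v\<in>I \<rightarrow>\<^sub>E {..<r}. \<kappa> ^ card (support I v) * (cmod (fourier r I f v))\<^sup>2)"

definition mean :: "nat \<Rightarrow> 'i set \<Rightarrow> (('i \<Rightarrow> nat) \<Rightarrow> real) \<Rightarrow> real" where
  "mean r I f = (\<Sum>x\<in>I \<rightarrow>\<^sub>E {..<r}. f x) / real (r ^ card I)"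

lemma mean_insert:
  assumes "finite I" "i \<notin> I"
  shows "mean r (insert i I) f = (\<Sum>a<r. mean r I (\<lambda>x. f (x(i := a)))) / r"
  using assms by (simp add: mean_def sum_PiE_insert sum_divide_distrib mult.commute)

lemma fourier_zero:
  assumes "\<And>i. i \<in> I \<Longrightarrow> v i = 0"
  shows "fourier r I f v = of_real (mean r I f)"
  using assms by (simp add: fourier_def mean_def character_def)

lemma character_upd:
  assumes "finite I" "i \<notin> I"
  shows "character r (insert i I) (v(i := c)) (x(i := a)) = zeta r ^ (c * a) * character r I v x"
proof -
  have "(\<Prod>j\<in>I. zeta r ^ ((v(i := c)) j * (x(i := a)) j)) = (\<Prod>j\<in>I. zeta r ^ (v j * x j))"
    using assms by (intro prod.cong) auto
  then show ?thesis
    using assms by (simp add: character_def)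
qed

lemma fourier_insert:
  assumes "finite I" "i \<notin> I"
  shows "fourier r (insert i I) f (v(i := c))
     = (\<Sum>a<r. zeta r ^ (c * a) * fourier r I (\<lambda>x. f (x(i := a))) v) / r"
  using assms
  by (simp add: fourier_def sum_PiE_insert character_upd sum_divide_distrib sum_distrib_left mult_ac)

lemma fourier_average:
  "fourier r I (\<lambda>x. (\<Sum>a<r. F a x) / r) v = (\<Sum>a<r. fourier r I (F a) v) / r"
proof -
  have "(\<Sum>x\<in>I \<rightarrow>\<^sub>E {..<r}. complex_of_real ((\<Sum>a<r. F a x) / r) * character r I v x)
     = (\<Sum>x\<in>I \<rightarrow>\<^sub>E {..<r}. \<Sum>a<r. complex_of_real (F a x) * character r I v x / r)"
    by (simp add: sum_divide_distrib sum_distrib_right)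
  also have "\<dots> = (\<Sum>a<r. \<Sum>x\<in>I \<rightarrow>\<^sub>E {..<r}. complex_of_real (F a x) * character r I v x / r)"
    by (rule sum.swap)
  finally show ?thesis
    by (simp only: fourier_def) (simp add: sum_divide_distrib mult.commute)
qed

lemma support_upd:
  assumes "finite I" "i \<notin> I"
  shows "card (support (insert i I) (v(i := c))) = (if c = 0 then 0 else 1) + card (support I v)"
proof -
  have "support (insert i I) (v(i := c)) = (if c = 0 then support I v else insert i (support I v))"
    using assms by (auto simp: support_def)
  moreover have "i \<notin> support I v" "finite (support I v)"
    using assms by (auto simp: support_def)
  ultimately show ?thesis by simp
qed

text \<open>The weight that is 1 at \<open>c = 0\<close> and \<kappa> elsewhere equals \<kappa>
  everywhere plus \<open>1 - \<kappa>\<close> at \<open>c = 0\<close>. Parseval in the new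
  coordinate turns the first part into an average over restrictions; the frequency
  \<open>c = 0\<close> belongs to the function averaged over that coordinate.\<close>

lemma noisy_weight_insert:
  assumes "finite I" "i \<notin> I" "0 < r"
  shows "noisy_weight \<kappa> r (insert i I) f
     = \<kappa> * ((\<Sum>a<r. noisy_weight \<kappa> r I (\<lambda>x. f (x(i := a)))) / r)
       + (1 - \<kappa>) * noisy_weight \<kappa> r I (\<lambda>x. (\<Sum>a<r. f (x(i := a))) / r)"
proof -
  define g where "g = (\<lambda>v a. fourier r I (\<lambda>x. f (x(i := a))) v)"
  define h where "h = (\<lambda>v c. (\<Sum>a<r. zeta r ^ (c * a) * g v a) / r)"
  have "(\<Sum>c<r. \<kappa> ^ (if c = 0 then 0 else 1) * (cmod (h v c))\<^sup>2)
     = \<kappa> * (\<Sum>c<r. (cmod (h v c))\<^sup>2) + (1 - \<kappa>) * (cmod (h v 0))\<^sup>2" for v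
  proof -
    have "(\<Sum>c<r. \<kappa> ^ (if c = 0 then 0 else 1) * (cmod (h v c))\<^sup>2)
       = (\<Sum>c<r. \<kappa> * (cmod (h v c))\<^sup>2 + (if c = 0 then (1 - \<kappa>) * (cmod (h v 0))\<^sup>2 else 0))"
      by (intro sum.cong) (auto simp: algebra_simps)
    then show ?thesis
      using assms(3) by (simp add: sum.distrib sum_distrib_left)
  qed
  moreover have "(\<Sum>c<r. (cmod (h v c))\<^sup>2) = (\<Sum>a<r. (cmod (g v a))\<^sup>2) / r" for v
    using parseval_one[of r "g v"] assms(3)
    by (simp add: h_def norm_divide power_divide sum_divide_distrib[symmetric] power2_eq_square)
  ultimately have split: "(\<Sum>c<r. \<kappa> ^ (if c = 0 then 0 else 1) * (cmod (h v c))\<^sup>2)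
     = \<kappa> * ((\<Sum>a<r. (cmod (g v a))\<^sup>2) / r) + (1 - \<kappa>) * (cmod ((\<Sum>a<r. g v a) / r))\<^sup>2" for v
    by (simp add: h_def)
  have "noisy_weight \<kappa> r (insert i I) f
     = (\<Sum>v\<in>I \<rightarrow>\<^sub>E {..<r}. \<Sum>c<r. \<kappa> ^ card (support I v) *
          (\<kappa> ^ (if c = 0 then 0 else 1) * (cmod (h v c))\<^sup>2))"
    unfolding noisy_weight_def sum_PiE_insert[OF assms(2)] h_def g_def
    using assms by (subst sum.swap) (simp add: fourier_insert support_upd power_add mult_ac)
  also have "\<dots> = (\<Sum>v\<in>I \<rightarrow>\<^sub>E {..<r}. \<kappa> ^ card (support I v) *
       (\<kappa> * ((\<Sum>a<r. (cmod (g v a))\<^sup>2) / r) + (1 - \<kappa>) * (cmod ((\<Sum>a<r. g v a) / r))\<^sup>2))"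
    by (simp only: sum_distrib_left[symmetric] split)
  also have "\<dots> = \<kappa> * ((\<Sum>v\<in>I \<rightarrow>\<^sub>E {..<r}. \<Sum>a<r. \<kappa> ^ card (support I v) * (cmod (g v a))\<^sup>2) / r)
       + (1 - \<kappa>) * (\<Sum>v\<in>I \<rightarrow>\<^sub>E {..<r}. \<kappa> ^ card (support I v) * (cmod ((\<Sum>a<r. g v a) / r))\<^sup>2)"
    by (simp add: distrib_left sum.distrib sum_distrib_left sum_divide_distrib mult_ac)
  also have "(\<Sum>v\<in>I \<rightarrow>\<^sub>E {..<r}. \<Sum>a<r. \<kappa> ^ card (support I v) * (cmod (g v a))\<^sup>2)
     = (\<Sum>a<r. noisy_weight \<kappa> r I (\<lambda>x. f (x(i := a))))"
    by (subst sum.swap) (simp add: noisy_weight_def g_def)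
  also have "(\<Sum>v\<in>I \<rightarrow>\<^sub>E {..<r}. \<kappa> ^ card (support I v) * (cmod ((\<Sum>a<r. g v a) / r))\<^sup>2)
     = noisy_weight \<kappa> r I (\<lambda>x. (\<Sum>a<r. f (x(i := a))) / r)"
    by (simp add: noisy_weight_def g_def fourier_average)
  finally show ?thesis .
qed

lemma noisy_weight_nonneg: "0 \<le> \<kappa> \<Longrightarrow> 0 \<le> noisy_weight \<kappa> r I f"
  unfolding noisy_weight_def by (intro sum_nonneg) auto

lemma noisy_weight_empty: "noisy_weight \<kappa> r {} f = (f (\<lambda>_. undefined))\<^sup>2"
  by (simp add: noisy_weight_def fourier_def character_def support_def)

lemma parseval:
  assumes "finite I" "0 < r"
  shows "(\<Sum>v\<in>I \<rightarrow>\<^sub>E {..<r}. (cmod (fourier r I f v))\<^sup>2) = mean r I (\<lambda>x. (f x)\<^sup>2)"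
proof -
  \<comment> \<open>At \<kappa> = 1 the second term of the recursion vanishes, and what remains is
    the recursion of \<open>mean\<close>.\<close>
  have "noisy_weight 1 r I f = mean r I (\<lambda>x. (f x)\<^sup>2)"
    using assms(1)
  proof (induction I arbitrary: f)
    case empty
    show ?case by (simp add: noisy_weight_empty mean_def)
  next
    case (insert i I)
    then show ?case using assms(2) by (simp add: noisy_weight_insert mean_insert)
  qed
  then show ?thesis by (simp add: noisy_weight_def)
qed

text \<open>The square root of the noisy weight is a weighted Euclidean norm of the Fourier
  coefficients, so this is the triangle inequality. It turns the averaged function in
  \<open>noisy_weight_insert\<close> into an average of norms, which is the shape of the
  one-variable bound.\<close>

lemma sqrt_noisy_weight_average:
  assumes "0 \<le> \<kappa>"
  shows "sqrt (noisy_weight \<kappa> r I (\<lambda>x. (\<Sum>a<r. F a x) / r)) \<le> (\<Sum>a<r. sqrt (noisy_weight \<kappa> r I (F a))) / r"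
proof -
  define B where "B = (\<lambda>a v. sqrt (\<kappa> ^ card (support I v)) * cmod (fourier r I (F a) v))"
  have L2: "sqrt (noisy_weight \<kappa> r I G) = L2_set (\<lambda>v. sqrt (\<kappa> ^ card (support I v)) * cmod (fourier r I G v)) (I \<rightarrow>\<^sub>E {..<r})" for G
    using assms by (simp add: noisy_weight_def L2_set_def power_mult_distrib)
  have tri: "L2_set (\<lambda>v. \<Sum>a\<in>J. B a v) S \<le> (\<Sum>a\<in>J. L2_set (B a) S)" if "finite J" for J :: "nat set" and S
    using that
  proof (induction J)
    case empty
    show ?case by (simp add: L2_set_def)
  next
    case (insert j J)
    then show ?case
      using L2_set_triangle_ineq[of "B j" "\<lambda>v. \<Sum>a\<in>J. B a v" S] by (simp add: order_trans[OF _ add_left_mono])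
  qed
  have "sqrt (noisy_weight \<kappa> r I (\<lambda>x. (\<Sum>a<r. F a x) / r)) \<le> L2_set (\<lambda>v. (1 / r) * (\<Sum>a<r. B a v)) (I \<rightarrow>\<^sub>E {..<r})"
    unfolding L2
  proof (rule L2_set_mono)
    fix v
    have "cmod (fourier r I (\<lambda>x. (\<Sum>a<r. F a x) / r) v) \<le> (\<Sum>a<r. cmod (fourier r I (F a) v)) / r"
      unfolding fourier_average norm_divide by (simp add: divide_right_mono norm_sum)
    then have "sqrt (\<kappa> ^ card (support I v)) * cmod (fourier r I (\<lambda>x. (\<Sum>a<r. F a x) / r) v)
       \<le> sqrt (\<kappa> ^ card (support I v)) * ((\<Sum>a<r. cmod (fourier r I (F a) v)) / r)"
      using assms by (intro mult_left_mono) auto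
    then show "sqrt (\<kappa> ^ card (support I v)) * cmod (fourier r I (\<lambda>x. (\<Sum>a<r. F a x) / r) v)
       \<le> 1 / r * (\<Sum>a<r. B a v)"
      by (simp add: B_def sum_distrib_left sum_divide_distrib)
  qed (use assms in auto)
  also have "\<dots> = (1 / r) * L2_set (\<lambda>v. \<Sum>a<r. B a v) (I \<rightarrow>\<^sub>E {..<r})"
    by (rule L2_set_right_distrib[symmetric]) auto
  also have "\<dots> \<le> (1 / r) * (\<Sum>a<r. L2_set (B a) (I \<rightarrow>\<^sub>E {..<r}))"
    using tri by (intro mult_left_mono) auto
  also have "\<dots> = (\<Sum>a<r. sqrt (noisy_weight \<kappa> r I (F a))) / r"
    by (simp add: L2 B_def)
  finally show ?thesis .
qed

lemma mean_nonneg: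
  "(\<And>x. x \<in> I \<rightarrow>\<^sub>E {..<r} \<Longrightarrow> 0 \<le> f x) \<Longrightarrow> 0 \<le> mean r I f"
  unfolding mean_def by (intro divide_nonneg_nonneg sum_nonneg) auto

text \<open>Tensorisation by induction on the coordinates. The one-variable bound is applied to the
  norms \<open>N a\<close> of the restrictions rather than to values of \<open>f\<close>; the
  induction hypothesis, raised to the power \<open>(1 + \<delta>) / 2\<close>, then replaces each
  \<open>N a powr (1 + \<delta>)\<close> by the moment \<open>E a\<close> of the
  restriction.\<close>

lemma hypercontractive:
  fixes f :: "('i \<Rightarrow> nat) \<Rightarrow> real"
  assumes "finite I" "0 < r" "\<And>x. x \<in> I \<rightarrow>\<^sub>E {..<r} \<Longrightarrow> 0 \<le> f x" "0 < \<delta>" "\<delta> \<le> 1"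
  shows "noisy_weight (\<delta> / (2 * real r)) r I f \<le> mean r I (\<lambda>x. f x powr (1 + \<delta>)) powr (2 / (1 + \<delta>))"
  using assms(1,3)
proof (induction I arbitrary: f)
  case empty
  have "(1 + \<delta>) * (2 / (1 + \<delta>)) = 2" using assms by (simp add: divide_eq_eq)
  moreover have "0 \<le> f (\<lambda>_. undefined)" using empty by auto
  ultimately show ?case
    by (simp add: noisy_weight_empty mean_def powr_powr powr_numeral del: times_divide_eq_right)
next
  case (insert i I)
  define \<kappa> where "\<kappa> = \<delta> / (2 * real r)"
  have "\<delta> / (2 * real r) \<le> 1 / 1"
    using assms by (intro frac_le) auto
  then have \<kappa>: "0 \<le> \<kappa>" "\<kappa> \<le> 1" using assms by (auto simp: \<kappa>_def)
  define F where "F = (\<lambda>a x. f (x(i := a)))"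
  have F0: "0 \<le> F a x" if "a < r" "x \<in> I \<rightarrow>\<^sub>E {..<r}" for a x
  proof -
    have "x(i := a) \<in> insert i I \<rightarrow>\<^sub>E {..<r}"
      using that by (auto simp: PiE_def extensional_def)
    then show ?thesis using insert.prems by (simp add: F_def)
  qed
  define N where "N = (\<lambda>a. sqrt (noisy_weight \<kappa> r I (F a)))"
  have N2: "(N a)\<^sup>2 = noisy_weight \<kappa> r I (F a)" for a
    using \<kappa> by (simp add: N_def noisy_weight_nonneg)
  have N0: "0 \<le> N a" for a using \<kappa> by (simp add: N_def noisy_weight_nonneg)
  define E where "E = (\<lambda>a. mean r I (\<lambda>x. F a x powr (1 + \<delta>)))"
  have NE: "N a powr (1 + \<delta>) \<le> E a" if "a < r" for a
  proof -
    have "E a \<ge> 0" unfolding E_def by (intro mean_nonneg) auto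
    have "(N a)\<^sup>2 \<le> E a powr (2 / (1 + \<delta>))"
      using insert.IH[of "F a"] F0[OF that] by (simp add: N2 E_def \<kappa>_def)
    then have "((N a)\<^sup>2) powr ((1 + \<delta>) / 2) \<le> (E a powr (2 / (1 + \<delta>))) powr ((1 + \<delta>) / 2)"
      using assms by (intro powr_mono2) auto
    also have "\<dots> = E a"
    proof -
      have "2 / (1 + \<delta>) * ((1 + \<delta>) / 2) = 1" using assms by (simp add: field_simps)
      then show ?thesis
        using \<open>E a \<ge> 0\<close> by (simp only: powr_powr powr_one)
    qed
    also have "((N a)\<^sup>2) powr ((1 + \<delta>) / 2) = N a powr (1 + \<delta>)"
    proof -
      have "(N a)\<^sup>2 = N a powr 2" using N0[of a] by simp
      moreover have "2 * ((1 + \<delta>) / 2) = 1 + \<delta>" by simp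
      ultimately show ?thesis by (simp only: powr_powr)
    qed
    finally show ?thesis .
  qed
  have "noisy_weight \<kappa> r I (\<lambda>x. (\<Sum>a<r. F a x) / r) \<le> ((\<Sum>a<r. N a) / r)\<^sup>2"
    using sqrt_noisy_weight_average[OF \<kappa>(1), of r I F]
    unfolding N_def[symmetric] by (rule sqrt_le_D)
  then have "noisy_weight \<kappa> r (insert i I) f
     \<le> \<kappa> * ((\<Sum>a<r. (N a)\<^sup>2) / r) + (1 - \<kappa>) * ((\<Sum>a<r. N a) / r)\<^sup>2"
    using \<kappa> insert.hyps assms unfolding N2 F_def
    by (simp add: noisy_weight_insert mult_left_mono)
  also have "\<dots> \<le> ((\<Sum>a<r. N a powr (1 + \<delta>)) / r) powr (2 / (1 + \<delta>))"
    unfolding \<kappa>_def using assms N0 by (intro one_variable_hypercontractive) auto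
  also have "\<dots> \<le> ((\<Sum>a<r. E a) / r) powr (2 / (1 + \<delta>))"
    using assms NE by (intro powr_mono2 divide_right_mono sum_mono divide_nonneg_nonneg sum_nonneg) auto
  also have "(\<Sum>a<r. E a) / r = mean r (insert i I) (\<lambda>x. f x powr (1 + \<delta>))"
    using insert.hyps by (simp add: mean_insert E_def F_def)
  finally show ?case by (simp add: \<kappa>_def)
qed

section \<open>Level inequality\<close>

definition level_weight :: "nat \<Rightarrow> 'i set \<Rightarrow> (('i \<Rightarrow> nat) \<Rightarrow> real) \<Rightarrow> nat \<Rightarrow> real" where
  "level_weight r I f j =
     (\<Sum>v | v \<in> I \<rightarrow>\<^sub>E {..<r} \<and> card (support I v) = j. (cmod (fourier r I f v))\<^sup>2)"

text \<open>Randomising the hypermatching moves the position of a support, so a level has to be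
  split according to the exact support.\<close>

definition support_weight :: "nat \<Rightarrow> 'i set \<Rightarrow> (('i \<Rightarrow> nat) \<Rightarrow> real) \<Rightarrow> 'i set \<Rightarrow> real" where
  "support_weight r I f S =
     (\<Sum>v | v \<in> I \<rightarrow>\<^sub>E {..<r} \<and> support I v = S. (cmod (fourier r I f v))\<^sup>2)"

definition rel_size :: "nat \<Rightarrow> 'i set \<Rightarrow> ('i \<Rightarrow> nat) set \<Rightarrow> real" where
  "rel_size r I A = card A / real (r ^ card I)"

lemma finite_vecs: "finite I \<Longrightarrow> finite (I \<rightarrow>\<^sub>E {..<r::nat})"
  by (intro finite_PiE) auto

lemma card_vecs: "finite I \<Longrightarrow> card (I \<rightarrow>\<^sub>E {..<r::nat}) = r ^ card I"
  by (simp add: card_PiE)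

lemma sum_indicator_vecs:
  fixes r :: nat
  assumes "finite I" "A \<subseteq> I \<rightarrow>\<^sub>E {..<r}"
  shows "(\<Sum>x\<in>I \<rightarrow>\<^sub>E {..<r}. indicator A x * g x) = (\<Sum>x\<in>A. g x :: complex)"
    and "(\<Sum>x\<in>I \<rightarrow>\<^sub>E {..<r}. indicator A x :: real) = card A"
proof -
  show "(\<Sum>x\<in>I \<rightarrow>\<^sub>E {..<r}. indicator A x * g x) = (\<Sum>x\<in>A. g x :: complex)"
    using assms finite_vecs[OF assms(1), of r]
    by (intro sum.mono_neutral_cong_right) (auto simp: indicator_def)
  show "(\<Sum>x\<in>I \<rightarrow>\<^sub>E {..<r}. indicator A x :: real) = card A"
    using assms finite_vecs[OF assms(1), of r]
    by (subst sum.mono_neutral_cong_right[of _ A _ "\<lambda>_. 1"]) (auto simp: indicator_def)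
qed

lemma mean_indicator:
  assumes "finite I" "A \<subseteq> I \<rightarrow>\<^sub>E {..<r}"
  shows "mean r I (indicator A) = rel_size r I A"
  using sum_indicator_vecs(2)[OF assms] by (simp add: mean_def rel_size_def)

lemma rel_size_le_1:
  assumes "finite I" "A \<subseteq> I \<rightarrow>\<^sub>E {..<r}" "0 < r"
  shows "rel_size r I A \<le> 1"
  using card_mono[OF finite_vecs[OF assms(1)] assms(2)] assms
  by (simp add: rel_size_def card_vecs)

lemma parseval_indicator:
  assumes "finite I" "A \<subseteq> I \<rightarrow>\<^sub>E {..<r}" "0 < r"
  shows "(\<Sum>v\<in>I \<rightarrow>\<^sub>E {..<r}. (cmod (fourier r I (indicator A) v))\<^sup>2) = rel_size r I A"
proof -
  have "(\<lambda>x. (indicator A x :: real)\<^sup>2) = indicator A"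
    by (auto simp: indicator_def)
  then show ?thesis
    using parseval[of I r "indicator A"] mean_indicator[of I A r] assms by simp
qed

lemma level_weight_nonneg: "0 \<le> level_weight r I f j"
  unfolding level_weight_def by (intro sum_nonneg) auto

text \<open>All moments of an indicator equal its density, so hypercontractivity bounds the noisy
  weight by a power of the density. Keeping a single level and dividing by its noise factor gives
  the claim.\<close>

lemma level_inequality:
  assumes "finite I" "A \<subseteq> I \<rightarrow>\<^sub>E {..<r}" "0 < r" "0 < \<delta>" "\<delta> \<le> 1" "A \<noteq> {}"
  shows "level_weight r I (indicator A) j
     \<le> (rel_size r I A)\<^sup>2 * rel_size r I A powr (- 2 * \<delta>) * (2 * real r / \<delta>) ^ j"
proof -
  define \<kappa> where "\<kappa> = \<delta> / (2 * real r)"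
  define \<mu> where "\<mu> = rel_size r I A"
  have "finite A" using assms finite_subset[OF assms(2) finite_vecs] by simp
  then have \<mu>: "0 < \<mu>" "\<mu> \<le> 1"
    using assms rel_size_le_1[of I A r] by (auto simp: \<mu>_def rel_size_def card_gt_0_iff)
  have \<kappa>: "0 < \<kappa>" using assms by (simp add: \<kappa>_def)
  have "\<kappa> ^ j * level_weight r I (indicator A) j
     = (\<Sum>v | v \<in> I \<rightarrow>\<^sub>E {..<r} \<and> card (support I v) = j.
          \<kappa> ^ card (support I v) * (cmod (fourier r I (indicator A) v))\<^sup>2)"
    by (simp add: level_weight_def sum_distrib_left)
  also have "\<dots> \<le> noisy_weight \<kappa> r I (indicator A)"
    unfolding noisy_weight_def using \<kappa> finite_vecs[OF assms(1), of r]
    by (intro sum_mono2) auto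
  also have "\<dots> \<le> mean r I (\<lambda>x. indicator A x powr (1 + \<delta>)) powr (2 / (1 + \<delta>))"
    unfolding \<kappa>_def using assms by (intro hypercontractive) auto
  also have "(\<lambda>x. (indicator A x :: real) powr (1 + \<delta>)) = indicator A"
    by (auto simp: indicator_def)
  also have "mean r I (indicator A) = \<mu>"
    using assms by (simp add: mean_indicator \<mu>_def)
  \<comment> \<open>The exponent is made linear in \<delta>, using
    \<open>(2 - 2 \<delta>) (1 + \<delta>) = 2 - 2 \<delta>^2 \<le> 2\<close>. As \<mu> \<le> 1, the
    smaller exponent gives the larger power.\<close>
  also have "\<mu> powr (2 / (1 + \<delta>)) \<le> \<mu> powr (2 + - 2 * \<delta>)"
  proof (rule powr_mono')
    have "(2 + - 2 * \<delta>) * (1 + \<delta>) \<le> 2" by (simp add: algebra_simps)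
    then show "2 + - 2 * \<delta> \<le> 2 / (1 + \<delta>)" using assms by (simp add: pos_le_divide_eq)
  qed (use \<mu> in auto)
  also have "\<dots> = \<mu>\<^sup>2 * \<mu> powr (- 2 * \<delta>)"
    using \<mu> by (simp only: powr_add) simp
  finally have le: "\<kappa> ^ j * level_weight r I (indicator A) j \<le> \<mu>\<^sup>2 * \<mu> powr (- 2 * \<delta>)" .
  have "level_weight r I (indicator A) j = (1 / \<kappa>) ^ j * (\<kappa> ^ j * level_weight r I (indicator A) j)"
    using \<kappa> by (simp add: power_divide)
  also have "\<dots> \<le> (1 / \<kappa>) ^ j * (\<mu>\<^sup>2 * \<mu> powr (- 2 * \<delta>))"
    using le \<kappa> by (intro mult_left_mono) auto
  also have "\<dots> = \<mu>\<^sup>2 * \<mu> powr (- 2 * \<delta>) * (2 * real r / \<delta>) ^ j"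
    by (simp add: \<kappa>_def mult_ac)
  finally show ?thesis by (simp only: \<mu>_def)
qed

lemma level_weight_eq_sum_support:
  assumes "finite I"
  shows "level_weight r I f j = (\<Sum>S | S \<subseteq> I \<and> card S = j. support_weight r I f S)"
proof -
  have "(\<Sum>S | S \<subseteq> I \<and> card S = j. support_weight r I f S)
    = (\<Sum>S | S \<subseteq> I \<and> card S = j. \<Sum>v | v \<in> {v \<in> I \<rightarrow>\<^sub>E {..<r}. card (support I v) = j} \<and> support I v = S.
         (cmod (fourier r I f v))\<^sup>2)"
    unfolding support_weight_def by (intro sum.cong) auto
  also have "\<dots> = (\<Sum>v\<in>{v \<in> I \<rightarrow>\<^sub>E {..<r}. card (support I v) = j}. (cmod (fourier r I f v))\<^sup>2)"
    using assms finite_vecs[OF assms, of r]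
    by (intro sum.group) (auto simp: support_def)
  finally show ?thesis by (simp add: level_weight_def)
qed

section \<open>Random hypermatchings\<close>

lemma permutes_transitive_on_subsets:
  assumes "finite D" "S \<subseteq> D" "S' \<subseteq> D" "card S = card S'"
  shows "\<exists>\<sigma>. \<sigma> permutes D \<and> \<sigma> ` S = S'"
proof -
  have fin: "finite S" "finite S'" using assms finite_subset by auto
  then obtain f where f: "bij_betw f S S'"
    using assms finite_same_card_bij by blast
  have "card (D - S) = card (D - S')"
    using assms fin by (simp add: card_Diff_subset)
  then obtain g where g: "bij_betw g (D - S) (D - S')"
    using assms finite_same_card_bij[of "D - S" "D - S'"] by auto
  define \<sigma> where "\<sigma> = (\<lambda>x. if x \<in> S then f x else if x \<in> D then g x else x)"
  have 1: "bij_betw \<sigma> S S'"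
    using f by (subst bij_betw_cong[of _ _ f]) (auto simp: \<sigma>_def)
  have "bij_betw \<sigma> (D - S) (D - S')"
    using g by (subst bij_betw_cong[of _ _ g]) (auto simp: \<sigma>_def)
  then have "bij_betw \<sigma> (S \<union> (D - S)) (S' \<union> (D - S'))"
    using 1 by (intro bij_betw_combine) auto
  then have "bij_betw \<sigma> D D"
    using assms by (simp add: Un_absorb1)
  then have "\<sigma> permutes D"
    using assms(2) by (intro bij_imp_permutes) (auto simp: \<sigma>_def)
  with 1 show ?thesis by (auto simp: bij_betw_def)
qed

text \<open>A uniformly random permutation sends \<open>U\<close> to a uniformly random set of the
  same size: composition with a permutation carrying \<open>S\<close> to \<open>S'\<close> injects
  the permutations that hit \<open>S\<close> into those that hit \<open>S'\<close>, so all fibres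
  have equal size.\<close>

lemma sum_permutes_image:
  fixes F :: "'a set \<Rightarrow> real"
  assumes D: "finite D" and U: "U \<subseteq> D"
  shows "(\<Sum>\<pi> | \<pi> permutes D. F (\<pi> ` U))
     = fact (card D) / (card D choose card U) * (\<Sum>S | S \<subseteq> D \<and> card S = card U. F S)"
proof -
  define \<P> where "\<P> = {\<pi>. \<pi> permutes D}"
  define \<S> where "\<S> = {S. S \<subseteq> D \<and> card S = card U}"
  define N where "N = (\<lambda>S. card {\<pi> \<in> \<P>. \<pi> ` U = S})"
  have finP: "finite \<P>" using D by (simp add: \<P>_def finite_permutations)
  have finS: "finite \<S>" using D by (simp add: \<S>_def)
  have inS: "\<pi> ` U \<in> \<S>" if "\<pi> \<in> \<P>" for \<pi>
  proof -
    have "inj \<pi>" "\<pi> ` D = D"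
      using that by (auto simp: \<P>_def permutes_inj permutes_image)
    then show ?thesis
      using U by (auto simp: \<S>_def card_image inj_on_subset[OF _ subset_UNIV])
  qed
  have group: "(\<Sum>\<pi>\<in>\<P>. G (\<pi> ` U)) = (\<Sum>S\<in>\<S>. N S * G S)" for G :: "'a set \<Rightarrow> real"
  proof -
    have "(\<Sum>\<pi>\<in>\<P>. G (\<pi> ` U)) = (\<Sum>S\<in>\<S>. \<Sum>\<pi> | \<pi> \<in> \<P> \<and> \<pi> ` U = S. G (\<pi> ` U))"
      using finP finS inS by (intro sum.group[symmetric]) auto
    also have "\<dots> = (\<Sum>S\<in>\<S>. \<Sum>\<pi> | \<pi> \<in> \<P> \<and> \<pi> ` U = S. G S)"
      by (intro sum.cong) auto
    finally show ?thesis by (simp add: N_def)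
  qed
  have le: "N S \<le> N S'" if S: "S \<in> \<S>" "S' \<in> \<S>" for S S'
  proof -
    obtain \<sigma> where \<sigma>: "\<sigma> permutes D" "\<sigma> ` S = S'"
      using permutes_transitive_on_subsets[OF D, of S S'] S by (auto simp: \<S>_def)
    have "inj \<sigma>" using \<sigma>(1) by (rule permutes_inj)
    then have "inj_on (\<lambda>\<pi>. \<sigma> \<circ> \<pi>) {\<pi> \<in> \<P>. \<pi> ` U = S}"
      by (auto simp: inj_on_def fun_eq_iff)
    moreover have "(\<lambda>\<pi>. \<sigma> \<circ> \<pi>) ` {\<pi> \<in> \<P>. \<pi> ` U = S} \<subseteq> {\<pi> \<in> \<P>. \<pi> ` U = S'}"
      using \<sigma> by (auto simp: \<P>_def image_comp[symmetric] intro: permutes_compose)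
    ultimately show ?thesis
      unfolding N_def using finP by (intro card_inj_on_le[of "\<lambda>\<pi>. \<sigma> \<circ> \<pi>"]) auto
  qed
  have U\<S>: "U \<in> \<S>" using U by (simp add: \<S>_def)
  have const: "N S = N U" if "S \<in> \<S>" for S
    using le[OF that U\<S>] le[OF U\<S> that] by simp
  have "fact (card D) = (\<Sum>\<pi>\<in>\<P>. 1 :: real)"
    using D by (simp add: \<P>_def card_permutations)
  also have "\<dots> = (\<Sum>S\<in>\<S>. N U)"
    using group[of "\<lambda>_. 1"] const by simp
  also have "\<dots> = (card D choose card U) * N U"
    using n_subsets[OF D] by (simp add: \<S>_def)
  finally have NU: "real (N U) = fact (card D) / (card D choose card U)"
    using card_mono[OF D U] by (simp add: field_simps)
  have "(\<Sum>\<pi>\<in>\<P>. F (\<pi> ` U)) = (\<Sum>S\<in>\<S>. N U * F S)"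
    using group[of F] const by simp
  then show ?thesis
    by (simp add: \<P>_def \<S>_def NU sum_distrib_left)
qed

section \<open>The Fourier coefficients of \<open>M x\<close> and the bias of a test on it\<close>

definition transpose_vec :: "nat \<Rightarrow> nat \<Rightarrow> nat set list \<Rightarrow> (nat \<Rightarrow> nat) \<Rightarrow> (nat \<Rightarrow> nat)" where
  "transpose_vec r n M s = (\<lambda>j\<in>{..<n}. (\<Sum>i<length M. incidence M i j * s i) mod r)"

lemma mult_vec_in: "0 < r \<Longrightarrow> mult_vec r n M x \<in> Zr_vec r (length M)"
  by (auto simp: mult_vec_def Zr_vec_def)

lemma transpose_vec_in: "0 < r \<Longrightarrow> transpose_vec r n M s \<in> {..<n} \<rightarrow>\<^sub>E {..<r}"
  by (auto simp: transpose_vec_def)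

lemma zeta_power_mod_mult:
  assumes "0 < r"
  shows "zeta r ^ (a * (b mod r)) = zeta r ^ (a * b)" "zeta r ^ (b mod r * a) = zeta r ^ (b * a)"
  by (metis assms mod_mult_right_eq zeta_power_mod, metis assms mod_mult_left_eq zeta_power_mod)

text \<open>In the exponent this is the adjoint identity between \<open>M\<close> and its transpose;
  the reductions modulo \<open>r\<close> disappear because \<open>zeta r ^ r = 1\<close>.\<close>

lemma character_mult_vec:
  assumes "0 < r"
  shows "character r {..<length M} s (mult_vec r n M x) = character r {..<n} (transpose_vec r n M s) x"
proof -
  have "character r {..<length M} s (mult_vec r n M x)
     = (\<Prod>i<length M. \<Prod>j<n. zeta r ^ (incidence M i j * s i * x j))"
    using assms
    by (simp add: character_def mult_vec_def zeta_power_mod_mult sum_distrib_left power_sum mult_ac)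
  also have "\<dots> = (\<Prod>j<n. \<Prod>i<length M. zeta r ^ (incidence M i j * s i * x j))"
    by (rule prod.swap)
  also have "\<dots> = character r {..<n} (transpose_vec r n M s) x"
    using assms
    by (simp add: character_def transpose_vec_def zeta_power_mod_mult sum_distrib_right power_sum)
  finally show ?thesis .
qed

lemma transpose_vec_edge:
  assumes M: "\<And>i i'. i < length M \<Longrightarrow> i' < length M \<Longrightarrow> i \<noteq> i' \<Longrightarrow> M ! i \<inter> M ! i' = {}"
    and "i < length M" "j \<in> M ! i" "j < n" "s i < r"
  shows "transpose_vec r n M s j = s i"
proof -
  have "(\<Sum>i'<length M. incidence M i' j * s i') = (\<Sum>i'<length M. if i' = i then s i else 0)"
    using assms by (intro sum.cong) (auto simp: incidence_def)
  then show ?thesis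
    using assms by (simp add: transpose_vec_def)
qed

lemma support_transpose_vec:
  assumes M: "\<And>i i'. i < length M \<Longrightarrow> i' < length M \<Longrightarrow> i \<noteq> i' \<Longrightarrow> M ! i \<inter> M ! i' = {}"
    and n: "\<And>i. i < length M \<Longrightarrow> M ! i \<subseteq> {..<n}"
    and s: "s \<in> {..<length M} \<rightarrow>\<^sub>E {..<r}"
  shows "support {..<n} (transpose_vec r n M s) = (\<Union>i\<in>support {..<length M} s. M ! i)"
proof (rule set_eqI)
  fix j
  show "j \<in> support {..<n} (transpose_vec r n M s) \<longleftrightarrow> j \<in> (\<Union>i\<in>support {..<length M} s. M ! i)"
  proof (cases "\<exists>i<length M. j \<in> M ! i")
    case True
    then obtain i where i: "i < length M" "j \<in> M ! i" by auto
    then have j: "j < n" using n[of i] by auto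
    have "s i < r" using s i(1) by auto
    then have eq: "transpose_vec r n M s j = s i"
      using transpose_vec_edge[OF M i j] by simp
    have uniq: "i' = i" if "i' < length M" "j \<in> M ! i'" for i'
      using M[of i i'] i that by auto
    have "j \<in> (\<Union>i\<in>support {..<length M} s. M ! i) \<longleftrightarrow> s i \<noteq> 0"
      unfolding support_def using i uniq by blast
    then show ?thesis
      using j eq by (simp add: support_def)
  next
    case False
    then have "transpose_vec r n M s j = 0" if "j < n"
      using that by (simp add: transpose_vec_def incidence_def)
    then show ?thesis
      using False by (auto simp: support_def)
  qed
qed

text \<open>The entry \<open>s i\<close> can be read off the transposed product at any vertex of
  edge \<open>i\<close>; for this the edges must be nonempty.\<close>

lemma inj_on_transpose_vec:
  assumes M: "\<And>i i'. i < length M \<Longrightarrow> i' < length M \<Longrightarrow> i \<noteq> i' \<Longrightarrow> M ! i \<inter> M ! i' = {}"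
    and n: "\<And>i. i < length M \<Longrightarrow> M ! i \<subseteq> {..<n}"
    and ne: "\<And>i. i < length M \<Longrightarrow> M ! i \<noteq> {}"
  shows "inj_on (transpose_vec r n M) ({..<length M} \<rightarrow>\<^sub>E {..<r})"
proof (rule inj_onI, rule PiE_ext)
  fix s s' i
  assume s: "s \<in> {..<length M} \<rightarrow>\<^sub>E {..<r}" "s' \<in> {..<length M} \<rightarrow>\<^sub>E {..<r}"
    and eq: "transpose_vec r n M s = transpose_vec r n M s'" and i: "i \<in> {..<length M}"
  obtain j where j: "j \<in> M ! i" using ne i by fastforce
  have i': "i < length M" and j': "j < n" and "s i < r" "s' i < r"
    using i j n[of i] s by auto
  then have "transpose_vec r n M s j = s i" "transpose_vec r n M s' j = s' i"
    using transpose_vec_edge[OF M i' j j'] by blast+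
  then show "s i = s' i" using eq by simp
qed

text \<open>
  Divided by the squared density of \<open>A\<close>, this is the chi-square distance from uniform of \<open>M x\<close>
  for uniform \<open>x \<in> A\<close>.
\<close>

definition excess :: "nat \<Rightarrow> nat \<Rightarrow> (nat \<Rightarrow> nat) set \<Rightarrow> nat set list \<Rightarrow> real" where
  "excess r n A M = (\<Sum>s | s \<in> Zr_vec r (length M) \<and> support {..<length M} s \<noteq> {}.
     (cmod (fourier r {..<n} (indicator A) (transpose_vec r n M s)))\<^sup>2)"

text \<open>Zero is the only frequency with empty support, and its coefficient is the density of
  \<open>A\<close>.\<close>

lemma sum_sq_zero_freq:
  assumes "0 < r" "A \<subseteq> Zr_vec r n"
  shows "(\<Sum>s\<in>Zr_vec r (length M). (cmod (fourier r {..<n} (indicator A) (transpose_vec r n M s)))\<^sup>2)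
     = (rel_size r {..<n} A)\<^sup>2 + excess r n A M"
proof -
  define z :: "nat \<Rightarrow> nat" where "z = (\<lambda>i\<in>{..<length M}. 0)"
  let ?W = "Zr_vec r (length M)"
  have fin: "finite ?W" by (simp add: Zr_vec_def finite_vecs)
  have zW: "z \<in> ?W" using assms by (auto simp: z_def Zr_vec_def)
  have supp: "support {..<length M} s = {} \<longleftrightarrow> s = z" if "s \<in> ?W" for s
  proof
    assume "support {..<length M} s = {}"
    then have "s i = z i" if "i \<in> {..<length M}" for i
      using that by (auto simp: support_def z_def)
    then show "s = z" using that zW unfolding Zr_vec_def by (intro PiE_ext)
  qed (simp add: support_def z_def)
  have "fourier r {..<n} (indicator A) (transpose_vec r n M z) = of_real (mean r {..<n} (indicator A))"
    by (rule fourier_zero) (simp add: transpose_vec_def z_def)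
  also have "mean r {..<n} (indicator A) = rel_size r {..<n} A"
    using assms by (intro mean_indicator) (auto simp: Zr_vec_def)
  finally have "(cmod (fourier r {..<n} (indicator A) (transpose_vec r n M z)))\<^sup>2 = (rel_size r {..<n} A)\<^sup>2"
    by simp
  moreover have "{s. s \<in> ?W \<and> support {..<length M} s \<noteq> {}} = ?W - {z}"
    using supp by auto
  ultimately show ?thesis
    unfolding excess_def using fin zW by (simp add: sum.remove[of ?W z])
qed

text \<open>Let \<open>p\<close> be the law of \<open>M x\<close> for uniform \<open>x\<close> in
  \<open>A\<close>; Parseval expresses its chi-square distance from uniform through
  \<open>excess\<close>. AM-GM with a free \<eta> is used instead of Cauchy-Schwarz so that the
  bound is linear in \<open>excess\<close> and can be averaged over hypermatchings directly.\<close>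

lemma mult_vec_bias:
  assumes r: "0 < r" and A: "A \<subseteq> Zr_vec r n" "A \<noteq> {}"
    and B: "B \<subseteq> Zr_vec r (length M)" and \<eta>: "0 < \<eta>"
  shows "card {x \<in> A. mult_vec r n M x \<in> B} - card A * (card B / r ^ length M)
     \<le> card A * (\<eta> / 2 + excess r n A M / (2 * \<eta> * (rel_size r {..<n} A)\<^sup>2))"
proof -
  let ?W = "Zr_vec r (length M)"
  define m where "m = length M"
  define R where "R = real (r ^ m)"
  define \<mu> where "\<mu> = rel_size r {..<n} A"
  define p where "p = (\<lambda>w. card {x \<in> A. mult_vec r n M x = w} / real (card A))"
  have R: "0 < R" using r by (simp add: R_def)
  have finW: "finite ?W" by (simp add: Zr_vec_def finite_vecs)
  have cardW: "card ?W = r ^ m" by (simp add: Zr_vec_def card_vecs m_def)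
  have finA: "finite A" using A finite_subset finite_vecs[of "{..<n}" r] by (auto simp: Zr_vec_def)
  have cA: "0 < real (card A)" using finA A by (simp add: card_gt_0_iff)
  have \<mu>: "card A = \<mu> * real (r ^ n)" "0 < \<mu>"
    using r cA by (simp_all add: \<mu>_def rel_size_def)
  have inW: "mult_vec r n M x \<in> ?W" for x using r by (rule mult_vec_in)
  have push: "(\<Sum>w\<in>?W. of_real (p w) * g w) = (\<Sum>x\<in>A. g (mult_vec r n M x)) / card A"
    for g :: "(nat \<Rightarrow> nat) \<Rightarrow> complex"
  proof -
    have "(\<Sum>x\<in>A. g (mult_vec r n M x)) = (\<Sum>w\<in>?W. \<Sum>x | x \<in> A \<and> mult_vec r n M x = w. g (mult_vec r n M x))"
      using finA finW inW by (intro sum.group[symmetric]) auto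
    also have "\<dots> = (\<Sum>w\<in>?W. of_nat (card {x \<in> A. mult_vec r n M x = w}) * g w)"
      by (intro sum.cong refl) simp
    finally show ?thesis
      by (simp add: p_def sum_divide_distrib)
  qed
  \<comment> \<open>The factor \<open>\<mu> * R\<close> collects the normalisations:
    \<open>card A\<close> is \<mu> times \<open>r ^ n\<close>, which the coefficient of the
    indicator already contains, and \<open>R\<close> is the normalisation on the side of
    \<open>p\<close>.\<close>
  have four: "fourier r {..<m} p s = fourier r {..<n} (indicator A) (transpose_vec r n M s) / (\<mu> * R)" for s
  proof -
    have "fourier r {..<m} p s = (\<Sum>x\<in>A. character r {..<n} (transpose_vec r n M s) x) / card A / R"
      using push[of "character r {..<m} s"] character_mult_vec[OF r, of M s]
      by (simp add: fourier_def m_def Zr_vec_def R_def)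
    moreover have "fourier r {..<n} (indicator A) (transpose_vec r n M s)
       = (\<Sum>x\<in>A. character r {..<n} (transpose_vec r n M s) x) / real (r ^ n)"
      using sum_indicator_vecs(1)[of "{..<n}" A r] A
      by (simp add: fourier_def Zr_vec_def of_real_indicator)
    moreover have "complex_of_real (real (card A)) = of_real (\<mu> * real (r ^ n))"
      using \<mu>(1) by (rule arg_cong)
    ultimately show ?thesis
      using r by simp
  qed
  have "(\<Sum>w\<in>?W. (p w)\<^sup>2) / R = (\<Sum>s\<in>?W. (cmod (fourier r {..<m} p s))\<^sup>2)"
    using parseval[of "{..<m}" r p] r by (simp add: mean_def Zr_vec_def m_def R_def)
  also have "\<dots> = (\<Sum>s\<in>?W. (cmod (fourier r {..<n} (indicator A) (transpose_vec r n M s)))\<^sup>2) / (\<mu> * R)\<^sup>2"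
    using \<mu> R by (simp add: four norm_divide norm_mult power_divide sum_divide_distrib)
  also have "\<dots> = (\<mu>\<^sup>2 + excess r n A M) / (\<mu> * R)\<^sup>2"
    using sum_sq_zero_freq[OF r A(1)] by (simp add: \<mu>_def)
  finally have psq: "R * (\<Sum>w\<in>?W. (p w)\<^sup>2) = 1 + excess r n A M / \<mu>\<^sup>2"
    using \<mu> R by (simp add: field_simps power2_eq_square)
  have "(\<Sum>w\<in>?W. of_real (p w) * 1 :: complex) = 1"
    using push[of "\<lambda>_. 1"] cA by simp
  then have "complex_of_real (\<Sum>w\<in>?W. p w) = of_real 1" by simp
  then have psum: "(\<Sum>w\<in>?W. p w) = 1" by (simp only: of_real_eq_iff)
  have "(\<Sum>w\<in>?W. (p w - 1 / R)\<^sup>2) = (\<Sum>w\<in>?W. (p w)\<^sup>2 - 2 / R * p w + 1 / R\<^sup>2)"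
    by (intro sum.cong refl) (simp add: power2_diff power_divide)
  also have "\<dots> = (\<Sum>w\<in>?W. (p w)\<^sup>2) - 2 / R * (\<Sum>w\<in>?W. p w) + R * (1 / R\<^sup>2)"
    by (simp add: sum.distrib sum_subtractf sum_distrib_left cardW R_def)
  also have "\<dots> = (\<Sum>w\<in>?W. (p w)\<^sup>2) - 1 / R"
    using R by (simp add: psum power2_eq_square)
  finally have "R * (\<Sum>w\<in>?W. (p w - 1 / R)\<^sup>2) = R * (\<Sum>w\<in>?W. (p w)\<^sup>2) - R * (1 / R)"
    by (simp only: right_diff_distrib)
  then have chi: "R * (\<Sum>w\<in>?W. (p w - 1 / R)\<^sup>2) = excess r n A M / \<mu>\<^sup>2"
    using R psq by simp
  \<comment> \<open>AM-GM with the weight \<open>\<eta> / R\<close>\<close>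
  have amgm: "g \<le> \<eta> / (2 * R) + R * g\<^sup>2 / (2 * \<eta>)" for g
  proof -
    have "0 \<le> (g * R - \<eta>)\<^sup>2 / (2 * \<eta> * R)" using R \<eta> by simp
    also have "\<dots> = R * g\<^sup>2 / (2 * \<eta>) - g + \<eta> / (2 * R)"
      using R \<eta> by (simp add: power2_diff field_simps power2_eq_square)
    finally show ?thesis by simp
  qed
  have "(\<Sum>w\<in>B. p w - 1 / R) \<le> (\<Sum>w\<in>B. \<eta> / (2 * R) + R * (p w - 1 / R)\<^sup>2 / (2 * \<eta>))"
    by (intro sum_mono amgm)
  \<comment> \<open>All summands are nonnegative, so the sum may run over all \<open>R\<close>
    vectors. The constant part then adds up to \<open>\<eta> / 2\<close>, and the bound no longer
    depends on \<open>B\<close>.\<close>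
  also have "\<dots> \<le> (\<Sum>w\<in>?W. \<eta> / (2 * R) + R * (p w - 1 / R)\<^sup>2 / (2 * \<eta>))"
    using B finW R \<eta> by (intro sum_mono2) auto
  also have "\<dots> = \<eta> / 2 + R * (\<Sum>w\<in>?W. (p w - 1 / R)\<^sup>2) / (2 * \<eta>)"
    using r by (simp add: sum.distrib sum_distrib_left sum_divide_distrib cardW R_def)
  finally have bias: "(\<Sum>w\<in>B. p w) - card B / R \<le> \<eta> / 2 + excess r n A M / (2 * \<eta> * \<mu>\<^sup>2)"
    unfolding chi by (simp add: sum_subtractf mult_ac)
  have "card {x \<in> A. mult_vec r n M x \<in> B} = (\<Sum>x\<in>{x \<in> A. mult_vec r n M x \<in> B}. 1)"
    by simp
  also have "\<dots> = (\<Sum>w\<in>B. \<Sum>x | x \<in> {x \<in> A. mult_vec r n M x \<in> B} \<and> mult_vec r n M x = w. 1)"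
    using finA finite_subset[OF B finW] by (intro sum.group[symmetric]) auto
  also have "\<dots> = (\<Sum>w\<in>B. card {x \<in> A. mult_vec r n M x = w})"
    by (intro sum.cong refl) (auto intro!: arg_cong[where f = card])
  finally have "real (card {x \<in> A. mult_vec r n M x \<in> B}) = card A * (\<Sum>w\<in>B. p w)"
    using cA by (simp add: p_def sum_divide_distrib[symmetric])
  then have "card {x \<in> A. mult_vec r n M x \<in> B} - card A * (card B / R)
     = card A * ((\<Sum>w\<in>B. p w) - card B / R)"
    by (simp add: algebra_simps)
  also have "\<dots> \<le> card A * (\<eta> / 2 + excess r n A M / (2 * \<eta> * \<mu>\<^sup>2))"
    using bias by (intro mult_left_mono) auto
  finally show ?thesis by (simp add: R_def m_def \<mu>_def)
qed

text \<open>
  A random hypermatching is the image of the consecutive blocks of length \<open>t\<close> under a uniformly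
  random permutation \<open>\<pi>\<close> of the vertices.
\<close>

definition blocks :: "nat \<Rightarrow> nat \<Rightarrow> (nat \<Rightarrow> nat) \<Rightarrow> nat set list" where
  "blocks t m \<pi> = map (\<lambda>i. \<pi> ` {i * t..<i * t + t}) [0..<m]"

lemma length_blocks [simp]: "length (blocks t m \<pi>) = m"
  by (simp add: blocks_def)

lemma nth_blocks [simp]: "i < m \<Longrightarrow> blocks t m \<pi> ! i = \<pi> ` {i * t..<i * t + t}"
  by (simp add: blocks_def)

lemma block_disjoint:
  fixes i i' t :: nat
  assumes "i \<noteq> i'"
  shows "{i * t..<i * t + t} \<inter> {i' * t..<i' * t + t} = {}"
proof -
  have "j div t = i" if "j \<in> {i * t..<i * t + t}" for i j
    using that by (intro div_nat_eqI) (auto simp: mult.commute)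
  then show ?thesis using assms by blast
qed

lemma block_subset:
  fixes i t m n :: nat
  assumes "i < m" "t * m \<le> n"
  shows "{i * t..<i * t + t} \<subseteq> {..<n}"
proof -
  have "Suc i * t \<le> m * t" using assms by (intro mult_right_mono) auto
  then show ?thesis using assms by (auto simp: mult.commute)
qed

lemma blocks_props:
  assumes "\<pi> permutes {..<n}" "t * m \<le> n" "0 < t"
  shows "\<And>i i'. i < m \<Longrightarrow> i' < m \<Longrightarrow> i \<noteq> i' \<Longrightarrow> blocks t m \<pi> ! i \<inter> blocks t m \<pi> ! i' = {}"
    and "\<And>i. i < m \<Longrightarrow> blocks t m \<pi> ! i \<subseteq> {..<n}"
    and "\<And>i. i < m \<Longrightarrow> blocks t m \<pi> ! i \<noteq> {}"
    and "\<And>i. i < m \<Longrightarrow> card (blocks t m \<pi> ! i) = t"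
proof -
  have inj: "inj \<pi>" and img: "\<pi> ` {..<n} = {..<n}"
    using assms by (auto simp: permutes_inj permutes_image)
  show "blocks t m \<pi> ! i \<inter> blocks t m \<pi> ! i' = {}" if "i < m" "i' < m" "i \<noteq> i'" for i i'
    using that block_disjoint[of i i' t] inj by (simp add: image_Int[OF inj, symmetric])
  show "blocks t m \<pi> ! i \<subseteq> {..<n}" if "i < m" for i
    using that image_mono[OF block_subset[OF that assms(2)], of \<pi>] img by simp
  show "blocks t m \<pi> ! i \<noteq> {}" if "i < m" for i
    using that assms by simp
  show "card (blocks t m \<pi> ! i) = t" if "i < m" for i
    using that inj by (simp add: card_image inj_on_subset[OF inj subset_UNIV])
qed

lemma blocks_in_hypermatchings:
  assumes "\<pi> permutes {..<n}" "t * m \<le> n" "0 < t" "real m = \<alpha> * real n / real t"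
  shows "blocks t m \<pi> \<in> hypermatchings \<alpha> t n"
  unfolding hypermatchings_def using blocks_props[OF assms(1-3)] assms(4) by auto

text \<open>Group the frequencies by their support \<open>K\<close>. For fixed \<open>K\<close>,
  transposition is injective into the vectors whose support is the union of the edges in
  \<open>K\<close>. It reaches only vectors that are constant on each edge, hence an
  inequality.\<close>

lemma excess_blocks_le:
  assumes "\<pi> permutes {..<n}" "t * m \<le> n" "0 < t" "0 < r"
  shows "excess r n A (blocks t m \<pi>)
     \<le> (\<Sum>K | K \<subseteq> {..<m} \<and> K \<noteq> {}.
          support_weight r {..<n} (indicator A) (\<pi> ` (\<Union>i\<in>K. {i * t..<i * t + t})))"
proof -
  let ?M = "blocks t m \<pi>"
  define T where "T = transpose_vec r n ?M"
  define h where "h = (\<lambda>v. (cmod (fourier r {..<n} (indicator A) v))\<^sup>2)"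
  define X where "X = {s. s \<in> Zr_vec r m \<and> support {..<m} s \<noteq> {}}"
  have X: "X \<subseteq> {..<m} \<rightarrow>\<^sub>E {..<r}" by (auto simp: X_def Zr_vec_def)
  have finX: "finite X" using finite_subset[OF X] by (simp add: finite_vecs)
  have inj: "inj_on T ({..<m} \<rightarrow>\<^sub>E {..<r})"
    unfolding T_def using inj_on_transpose_vec[of ?M n r] blocks_props[OF assms(1-3)] by simp
  have supp: "support {..<n} (T s) = \<pi> ` (\<Union>i\<in>support {..<m} s. {i * t..<i * t + t})" if "s \<in> X" for s
  proof -
    have "s \<in> {..<m} \<rightarrow>\<^sub>E {..<r}" using that X by auto
    then have "support {..<n} (T s) = (\<Union>i\<in>support {..<m} s. ?M ! i)"
      using support_transpose_vec[of ?M n s r] blocks_props[OF assms(1-3)] by (simp add: T_def)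
    also have "\<dots> = (\<Union>i\<in>support {..<m} s. \<pi> ` {i * t..<i * t + t})"
      by (intro SUP_cong) (auto simp: support_def)
    finally show ?thesis by (simp only: image_UN)
  qed
  have "excess r n A ?M = (\<Sum>s\<in>X. h (T s))"
    by (simp add: excess_def X_def h_def T_def)
  also have "\<dots> = (\<Sum>K\<in>{K. K \<subseteq> {..<m} \<and> K \<noteq> {}}. \<Sum>s | s \<in> X \<and> support {..<m} s = K. h (T s))"
    using finX by (intro sum.group[symmetric]) (auto simp: X_def support_def)
  also have "\<dots> \<le> (\<Sum>K | K \<subseteq> {..<m} \<and> K \<noteq> {}.
          support_weight r {..<n} (indicator A) (\<pi> ` (\<Union>i\<in>K. {i * t..<i * t + t})))"
  proof (intro sum_mono)
    fix K
    let ?Y = "{s. s \<in> X \<and> support {..<m} s = K}"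
    have "inj_on T ?Y" using inj X by (auto intro: inj_on_subset)
    then have "(\<Sum>s\<in>?Y. h (T s)) = (\<Sum>v\<in>T ` ?Y. h v)"
      by (simp add: sum.reindex)
    also have "\<dots> \<le> support_weight r {..<n} (indicator A) (\<pi> ` (\<Union>i\<in>K. {i * t..<i * t + t}))"
      unfolding support_weight_def h_def
    proof (intro sum_mono2)
      show "T ` ?Y \<subseteq> {v. v \<in> {..<n} \<rightarrow>\<^sub>E {..<r} \<and> support {..<n} v = \<pi> ` (\<Union>i\<in>K. {i * t..<i * t + t})}"
      proof (rule image_subsetI)
        fix s assume "s \<in> ?Y"
        then show "T s \<in> {v. v \<in> {..<n} \<rightarrow>\<^sub>E {..<r} \<and> support {..<n} v = \<pi> ` (\<Union>i\<in>K. {i * t..<i * t + t})}"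
          using supp[of s] transpose_vec_in[OF assms(4), of n ?M s] by (simp add: T_def)
      qed
    qed (auto simp: finite_vecs)
    finally show "(\<Sum>s\<in>?Y. h (T s)) \<le> support_weight r {..<n} (indicator A) (\<pi> ` (\<Union>i\<in>K. {i * t..<i * t + t}))" .
  qed
  finally show ?thesis .
qed

text \<open>An upper bound for the mean of \<open>excess\<close> over random \<open>blocks\<close>:
  there are \<open>m choose k\<close> sets of \<open>k\<close> edges, and the union of such a set is
  equally likely to be any of the \<open>n choose (t * k)\<close> sets of its size.\<close>

definition average_excess :: "nat \<Rightarrow> nat \<Rightarrow> nat \<Rightarrow> nat \<Rightarrow> (nat \<Rightarrow> nat) set \<Rightarrow> real" where
  "average_excess r t m n A =
     (\<Sum>k=1..m. (m choose k) / (n choose (t * k)) * level_weight r {..<n} (indicator A) (t * k))"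

text \<open>The total weight is 1 by Parseval, and the zero frequency already carries all of it.
  This serves the protocols that send no bits.\<close>

lemma level_weight_full:
  assumes "finite I" "0 < r" "0 < j"
  shows "level_weight r I (indicator (I \<rightarrow>\<^sub>E {..<r})) j \<le> 0"
proof -
  define f :: "('a \<Rightarrow> nat) \<Rightarrow> real" where "f = indicator (I \<rightarrow>\<^sub>E {..<r})"
  define z :: "'a \<Rightarrow> nat" where "z = (\<lambda>i\<in>I. 0)"
  define X where "X = {v. v \<in> I \<rightarrow>\<^sub>E {..<r} \<and> card (support I v) = j}"
  have full: "rel_size r I (I \<rightarrow>\<^sub>E {..<r}) = 1"
    using assms by (simp add: rel_size_def card_vecs)
  have z: "z \<in> I \<rightarrow>\<^sub>E {..<r}" "z \<notin> X"
    using assms by (auto simp: z_def X_def support_def)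
  have "fourier r I f z = of_real (mean r I f)"
    by (rule fourier_zero) (simp add: z_def)
  then have "(cmod (fourier r I f z))\<^sup>2 = 1"
    using mean_indicator[OF assms(1) order_refl, of r] full by (simp add: f_def)
  moreover have "finite X"
    using assms by (simp add: X_def finite_vecs)
  ultimately have "1 + level_weight r I f j = (\<Sum>v\<in>insert z X. (cmod (fourier r I f v))\<^sup>2)"
    using z by (simp add: level_weight_def X_def)
  also have "\<dots> \<le> (\<Sum>v\<in>I \<rightarrow>\<^sub>E {..<r}. (cmod (fourier r I f v))\<^sup>2)"
    using z assms by (intro sum_mono2) (auto simp: X_def finite_vecs)
  also have "\<dots> = 1"
    using parseval_indicator[OF assms(1) order_refl assms(2)] full by (simp add: f_def)
  finally show ?thesis by (simp add: f_def)
qed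

lemma average_excess_full:
  assumes "0 < r" "0 < t"
  shows "average_excess r t m n (Zr_vec r n) \<le> 0"
  unfolding average_excess_def Zr_vec_def
  using assms by (intro sum_nonpos mult_nonneg_nonpos level_weight_full) auto

lemma sum_excess_blocks:
  assumes "t * m \<le> n" "0 < t" "0 < r"
  shows "(\<Sum>\<pi> | \<pi> permutes {..<n}. excess r n A (blocks t m \<pi>)) \<le> fact n * average_excess r t m n A"
proof -
  define U where "U = (\<lambda>K. \<Union>i\<in>K. {i * t..<i * t + t})"
  define V where "V = support_weight r {..<n} (indicator A)"
  define G where "G = (\<lambda>k. level_weight r {..<n} (indicator A) (t * k) / (n choose (t * k)))"
  let ?Ks = "{K. K \<subseteq> {..<m} \<and> K \<noteq> {}}"
  have U: "U K \<subseteq> {..<n}" "card (U K) = t * card K" if "K \<in> ?Ks" for K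
  proof -
    show "U K \<subseteq> {..<n}" using that block_subset[OF _ assms(1)] by (force simp: U_def)
    have "finite K" using that finite_subset by auto
    then have "card (U K) = (\<Sum>i\<in>K. card {i * t..<i * t + t})"
      unfolding U_def using block_disjoint by (intro card_UN_disjoint) auto
    then show "card (U K) = t * card K" by simp
  qed
  have "(\<Sum>\<pi> | \<pi> permutes {..<n}. excess r n A (blocks t m \<pi>))
     \<le> (\<Sum>\<pi> | \<pi> permutes {..<n}. \<Sum>K\<in>?Ks. V (\<pi> ` U K))"
    unfolding V_def U_def using assms by (intro sum_mono excess_blocks_le) auto
  also have "\<dots> = (\<Sum>K\<in>?Ks. \<Sum>\<pi> | \<pi> permutes {..<n}. V (\<pi> ` U K))"
    by (rule sum.swap)
  also have "\<dots> = (\<Sum>K\<in>?Ks. fact n * G (card K))"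
  proof (intro sum.cong refl)
    fix K assume K: "K \<in> ?Ks"
    show "(\<Sum>\<pi> | \<pi> permutes {..<n}. V (\<pi> ` U K)) = fact n * G (card K)"
      using sum_permutes_image[of "{..<n}" "U K" V] U[OF K]
        level_weight_eq_sum_support[of "{..<n}" r "indicator A" "t * card K"]
      by (simp add: V_def G_def)
  qed
  also have "\<dots> = (\<Sum>k=1..m. \<Sum>K | K \<in> ?Ks \<and> card K = k. fact n * G (card K))"
  proof (intro sum.group[symmetric])
    show "card ` ?Ks \<subseteq> {1..m}"
      using card_mono[of "{..<m}"] finite_subset[of _ "{..<m}"] by (fastforce simp: Suc_le_eq card_gt_0_iff)
  qed auto
  also have "\<dots> = (\<Sum>k=1..m. (m choose k) * (fact n * G k))"
  proof (intro sum.cong refl)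
    fix k assume "k \<in> {1..m}"
    then have "{K. K \<in> ?Ks \<and> card K = k} = {K. K \<subseteq> {..<m} \<and> card K = k}" by auto
    then have "card {K. K \<in> ?Ks \<and> card K = k} = m choose k"
      using n_subsets[of "{..<m}" k] by simp
    then show "(\<Sum>K | K \<in> ?Ks \<and> card K = k. fact n * G (card K)) = (m choose k) * (fact n * G k)"
      by simp
  qed
  also have "\<dots> = fact n * average_excess r t m n A"
    by (simp add: average_excess_def G_def sum_distrib_left mult_ac)
  finally show ?thesis .
qed

section \<open>Bounding the average excess\<close>

lemma choose_Suc_mult: "Suc k * (m choose Suc k) = (m - k) * (m choose k)"
  by (simp only: binomial_absorption binomial_absorb_comp)

text \<open>The numerator grows by \<open>(m - k) / (k + 1)\<close>, and the first of the
  \<open>t\<close> steps in the denominator by \<open>(n - t k) / (t k + 1)\<close>. These compare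
  through \<open>t k + 1 \<le> t (k + 1)\<close> and \<open>t (m - k) \<le> n - t k\<close>. The
  other \<open>t - 1\<close> steps can only enlarge the denominator, since \<open>t m\<close> is at
  most half of \<open>n\<close>.\<close>

lemma choose_ratio_Suc:
  assumes "0 < t" "k < m" "2 * (t * m) \<le> n"
  shows "(m choose Suc k) / (n choose (t * Suc k)) \<le> (m choose k) / real (n choose (t * k))"
proof -
  have le: "t * Suc k \<le> t * m" using assms by (intro mult_left_mono) auto
  have "(n choose Suc (t * k)) \<le> n choose (t * Suc k)"
    using assms le by (intro binomial_mono) auto
  have "(m choose Suc k) * (n choose (t * k)) * (Suc k * Suc (t * k))
     = Suc k * (m choose Suc k) * (n choose (t * k)) * Suc (t * k)"
    by (simp only: mult_ac)
  also have "\<dots> = (m - k) * (m choose k) * (n choose (t * k)) * Suc (t * k)"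
    by (simp only: choose_Suc_mult)
  also have "\<dots> \<le> (Suc k * (n - t * k)) * (m choose k) * (n choose (t * k))"
  proof -
    have "t * (m - k) \<le> n - t * k" using assms by (simp add: diff_mult_distrib2)
    then have step: "Suc k * (t * (m - k)) \<le> Suc k * (n - t * k)" by (intro mult_left_mono) auto
    have "(m - k) * Suc (t * k) \<le> (m - k) * (Suc k * t)"
      using assms by (intro mult_left_mono) auto
    also have "\<dots> = Suc k * (t * (m - k))"
      by (simp only: mult_ac)
    also note step
    finally have "(m - k) * Suc (t * k) \<le> Suc k * (n - t * k)" .
    then have "((m - k) * Suc (t * k)) * ((m choose k) * (n choose (t * k)))
       \<le> (Suc k * (n - t * k)) * ((m choose k) * (n choose (t * k)))"
      by (intro mult_right_mono) auto
    then show ?thesis by (simp only: mult_ac)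
  qed
  also have "\<dots> = Suc k * (m choose k) * ((n - t * k) * (n choose (t * k)))"
    by (simp only: mult_ac)
  also have "\<dots> = Suc k * (m choose k) * (Suc (t * k) * (n choose Suc (t * k)))"
    by (simp only: choose_Suc_mult)
  also have "\<dots> = (Suc k * Suc (t * k)) * ((m choose k) * (n choose Suc (t * k)))"
    by (simp only: mult_ac)
  also have "\<dots> \<le> (Suc k * Suc (t * k)) * ((m choose k) * (n choose (t * Suc k)))"
    using \<open>(n choose Suc (t * k)) \<le> n choose (t * Suc k)\<close> by (intro mult_left_mono) auto
  finally have "((m choose Suc k) * (n choose (t * k))) * (Suc k * Suc (t * k))
     \<le> ((m choose k) * (n choose (t * Suc k))) * (Suc k * Suc (t * k))"
    by (simp only: mult_ac)
  then have "(m choose Suc k) * (n choose (t * k)) \<le> (m choose k) * (n choose (t * Suc k))"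
    by (simp only: mult_le_cancel2) auto
  then have "real (m choose Suc k) * real (n choose (t * k)) \<le> real (m choose k) * real (n choose (t * Suc k))"
    by (simp only: of_nat_mult[symmetric] of_nat_le_iff)
  moreover have "0 < n choose (t * k)" "0 < n choose (t * Suc k)"
    using assms le by (auto simp: zero_less_binomial_iff intro: order_trans)
  ultimately show ?thesis
    by (simp add: divide_simps)
qed

lemma choose_ratio_antimono:
  assumes "0 < t" "2 * (t * m) \<le> n" "k0 \<le> k" "k \<le> m"
  shows "(m choose k) / (n choose (t * k)) \<le> (m choose k0) / real (n choose (t * k0))"
  using assms(3,4)
proof (induction k rule: dec_induct)
  case (step k)
  then show ?case
    using choose_ratio_Suc[of t k m n] assms by simp
qed simp

lemma choose_ratio_le:
  assumes "0 < t" "0 < k" "k \<le> m" "t * m \<le> n"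
  shows "(m choose k) / (n choose (t * k)) \<le> (m * (real k * t / n) ^ t) ^ k"
proof -
  have le: "t * k \<le> n" using assms by (meson mult_le_mono2 order_trans)
  have "0 < t * k" using assms by simp
  then have pos: "0 < real (t * k)" "0 < real n"
    using le by linarith+
  have "(n / real (t * k)) ^ (t * k) \<le> n choose (t * k)"
    using binomial_ge_n_over_k_pow_k[OF le] by simp
  moreover have "real (m choose k) \<le> real (m ^ k)"
    using binomial_le_pow[OF assms(3)] by (simp only: of_nat_le_iff)
  ultimately have "(m choose k) / (n choose (t * k)) \<le> real m ^ k / (n / real (t * k)) ^ (t * k)"
    using pos by (intro frac_le) auto
  also have "\<dots> = real m ^ k * (real k * t / n) ^ (t * k)"
    using pos by (simp add: power_divide mult.commute)
  also have "\<dots> = (m * (real k * t / n) ^ t) ^ k"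
    by (simp only: power_mult power_mult_distrib)
  finally show ?thesis .
qed

lemma sum_power_le:
  fixes D :: real
  assumes "0 \<le> D" "D \<le> 1 / 2"
  shows "(\<Sum>k=1..m. D ^ k) \<le> 2 * D"
proof -
  \<comment> \<open>Counting the last term twice makes the bound inductive: for
    \<open>D \<le> 1/2\<close>, twice the next power is at most the current one.\<close>
  have bound: "(\<Sum>k=1..Suc m. D ^ k) + D ^ Suc m \<le> 2 * D" for m
  proof (induction m)
    case (Suc m)
    have "2 * (D * D ^ Suc m) \<le> 1 * D ^ Suc m"
      using assms mult_right_mono[of "2 * D" 1 "D ^ Suc m"] by simp
    then show ?case using Suc by simp
  qed simp
  then show ?thesis
  proof (cases m)
    case (Suc m')
    have "0 \<le> D ^ Suc m'" using assms by (intro zero_le_power) auto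
    then show ?thesis using bound[of m'] unfolding Suc by linarith
  qed (use assms in simp)
qed

lemma sum_level_weight_le:
  assumes "0 < r" "A \<subseteq> Zr_vec r n" "0 < t" "finite Ks"
  shows "(\<Sum>k\<in>Ks. level_weight r {..<n} (indicator A) (t * k)) \<le> rel_size r {..<n} A"
proof -
  define X where "X = (\<lambda>k. {v. v \<in> {..<n} \<rightarrow>\<^sub>E {..<r} \<and> card (support {..<n} v) = t * k})"
  have fin: "finite (X k)" for k by (simp add: X_def finite_vecs)
  have "(\<Sum>k\<in>Ks. level_weight r {..<n} (indicator A) (t * k))
     = (\<Sum>v\<in>(\<Union>k\<in>Ks. X k). (cmod (fourier r {..<n} (indicator A) v))\<^sup>2)"
    unfolding level_weight_def X_def[symmetric] using assms fin
    by (subst sum.UNION_disjoint) (auto simp: X_def)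
  also have "\<dots> \<le> (\<Sum>v\<in>{..<n} \<rightarrow>\<^sub>E {..<r}. (cmod (fourier r {..<n} (indicator A) v))\<^sup>2)"
    by (intro sum_mono2) (auto simp: X_def finite_vecs)
  also have "\<dots> = rel_size r {..<n} A"
    using assms by (intro parseval_indicator) (auto simp: Zr_vec_def)
  finally show ?thesis .
qed

text \<open>\<open>R\<close> is an upper bound for \<open>ln (1 / \<mu>) / t\<close>. In
  \<open>D\<close>, the factor \<open>2 * r\<close> comes from the inverse noise rate,
  \<open>exp 2\<close> from the loss \<open>\<mu> powr (- 2 * \<delta>)\<close>, and
  \<open>R * t / n\<close> from the binomial ratio once \<open>k\<close> has cancelled. The 3 is 2
  from the geometric series over \<open>k \<le> R\<close> plus 1 from the tail.\<close>

lemma average_excess_le: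
  fixes R :: real
  assumes t: "0 < t" and r: "0 < r" and m: "0 < m" "2 * (t * m) \<le> n"
    and A: "A \<subseteq> Zr_vec r n" "A \<noteq> {}" and R: "1 \<le> R"
    and \<mu>R: "exp (- (t * R)) \<le> rel_size r {..<n} A"
  defines "D \<equiv> m * (2 * exp 2 * r * R * t / n) ^ t"
  assumes D: "D \<le> 1 / 2"
  shows "average_excess r t m n A \<le> 3 * D * (rel_size r {..<n} A)\<^sup>2"
proof -
  define \<mu> where "\<mu> = rel_size r {..<n} A"
  define W where "W = (\<lambda>k. level_weight r {..<n} (indicator A) (t * k))"
  define P where "P = (\<lambda>k. (m choose k) / real (n choose (t * k)))"
  have n: "0 < n" using m t by (cases n) auto
  have tm: "t * m \<le> n" using m by simp
  have D0: "0 \<le> D" using R by (simp add: D_def)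
  have \<mu>: "exp (- (t * R)) \<le> \<mu>" "0 < \<mu>"
    using \<mu>R by (auto simp: \<mu>_def intro: less_le_trans[OF exp_gt_zero])
  have P0: "0 \<le> P k" for k by (simp add: P_def)
  have W0: "0 \<le> W k" for k by (simp add: W_def level_weight_nonneg)
  have small: "P k * W k \<le> \<mu>\<^sup>2 * D ^ k" if k: "0 < k" "k \<le> m" "real k \<le> R" for k
  proof -
    \<comment> \<open>This choice turns the loss \<open>\<mu> powr (- 2 * \<delta>)\<close> into a constant to the power \<open>t * k\<close>.\<close>
    define \<delta> where "\<delta> = k / R"
    have \<delta>: "0 < \<delta>" "\<delta> \<le> 1" using k R by (auto simp: \<delta>_def)
    have "\<mu> powr (- 2 * \<delta>) \<le> exp (- (t * R)) powr (- 2 * \<delta>)"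
      using \<mu> \<delta> by (intro powr_mono2') auto
    also have "\<dots> = exp (of_nat (t * k) * 2)"
      using R by (simp add: exp_powr_real \<delta>_def)
    also have "\<dots> = exp 2 ^ (t * k)"
      by (rule exp_of_nat_mult)
    finally have le: "\<mu>\<^sup>2 * \<mu> powr (- 2 * \<delta>) * (2 * real r / \<delta>) ^ (t * k) \<le> \<mu>\<^sup>2 * exp 2 ^ (t * k) * (2 * real r / \<delta>) ^ (t * k)"
      using \<delta> by (intro mult_right_mono mult_left_mono) auto
    have "W k \<le> \<mu>\<^sup>2 * \<mu> powr (- 2 * \<delta>) * (2 * real r / \<delta>) ^ (t * k)"
      unfolding W_def \<mu>_def using A r \<delta> by (intro level_inequality) (auto simp: Zr_vec_def)
    also note le
    finally have "W k \<le> \<mu>\<^sup>2 * (exp 2 * (2 * real r / \<delta>)) ^ (t * k)"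
      by (simp only: power_mult_distrib mult.assoc)
    moreover have "P k \<le> (m * (real k * t / n) ^ t) ^ k"
      unfolding P_def using t k tm by (intro choose_ratio_le) auto
    ultimately have "P k * W k \<le> (m * (real k * t / n) ^ t) ^ k * (\<mu>\<^sup>2 * (exp 2 * (2 * real r / \<delta>)) ^ (t * k))"
      using W0 by (intro mult_mono) auto
    also have "\<dots> = \<mu>\<^sup>2 * (m * (real k * t / n * (exp 2 * (2 * real r / \<delta>))) ^ t) ^ k"
      by (simp only: power_mult_distrib power_mult[symmetric] mult_ac)
    also have "real k * t / n * (exp 2 * (2 * real r / \<delta>)) = 2 * exp 2 * r * R * t / n"
      using k R by (simp add: \<delta>_def)
    finally show ?thesis by (simp add: D_def)
  qed
  \<comment> \<open>The first index beyond \<open>R\<close>. As \<open>R \<ge> 1\<close>, it is at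
    most \<open>2 * R\<close>, and this 2 fits the one already present in \<open>D\<close>.\<close>
  define k0 where "k0 = Suc (nat \<lfloor>R\<rfloor>)"
  have k0: "R < k0" "k0 \<le> 2 * R"
    using R by (auto simp: k0_def) linarith+
  have tail: "(\<Sum>k\<in>{k0..m}. P k * W k) \<le> \<mu>\<^sup>2 * D"
  proof (cases "k0 \<le> m")
    case True
    have "P k0 \<le> (m * (real k0 * t / n) ^ t) ^ k0"
      unfolding P_def using t True tm by (intro choose_ratio_le) (auto simp: k0_def)
    \<comment> \<open>Parseval will supply only one factor \<mu>. The second is inserted here at the
      price of \<open>exp 1\<close> per coordinate of the support, which \<open>exp 2 * r\<close> in
      \<open>D\<close> covers.\<close>
    moreover have "1 \<le> \<mu> * exp 1 ^ (t * k0)"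
    proof -
      have "1 = exp (- (t * R)) * exp (t * R)" by (simp add: exp_add[symmetric])
      also have "\<dots> \<le> \<mu> * exp (t * k0)"
        using \<mu> k0 by (intro mult_mono) (auto intro!: mult_left_mono)
      also have "exp (t * k0) = exp (1 :: real) ^ (t * k0)"
        using exp_of_nat_mult[of "t * k0" "1 :: real"] by simp
      finally show ?thesis .
    qed
    ultimately have "P k0 * 1 \<le> (m * (real k0 * t / n) ^ t) ^ k0 * (\<mu> * exp 1 ^ (t * k0))"
      by (intro mult_mono) auto
    also have "\<dots> = \<mu> * (m * (real k0 * t / n * exp 1) ^ t) ^ k0"
      by (simp only: power_mult_distrib power_mult[symmetric] mult_ac)
    also have "\<dots> \<le> \<mu> * D ^ k0"
    proof -
      have "exp (1 :: real) \<le> exp 2" by simp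
      moreover have "1 \<le> real r" using r by simp
      ultimately have "exp 1 * 1 \<le> exp 2 * real r" by (intro mult_mono) auto
      then have "real k0 * exp 1 \<le> (2 * R) * (exp 2 * real r)"
        using k0 R by (intro mult_mono) auto
      then have "real k0 * exp 1 * t / n \<le> (2 * R) * (exp 2 * real r) * t / n"
        by (intro divide_right_mono mult_right_mono) auto
      then have "real k0 * t / n * exp 1 \<le> 2 * exp 2 * r * R * t / n"
        by (simp add: mult_ac)
      then show ?thesis
        unfolding D_def using \<mu> by (intro mult_left_mono power_mono) auto
    qed
    also have "\<dots> \<le> \<mu> * D"
      using D0 D \<mu> power_decreasing[of 1 k0 D] by (simp add: k0_def)
    finally have Pk0: "P k0 \<le> \<mu> * D" by simp
    have "(\<Sum>k\<in>{k0..m}. P k * W k) \<le> (\<Sum>k\<in>{k0..m}. P k0 * W k)"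
    proof (intro sum_mono mult_right_mono W0)
      fix k assume "k \<in> {k0..m}"
      then show "P k \<le> P k0"
        unfolding P_def using choose_ratio_antimono[OF t m(2), of k0 k] by simp
    qed
    also have "\<dots> = P k0 * (\<Sum>k\<in>{k0..m}. W k)"
      by (simp add: sum_distrib_left)
    also have "\<dots> \<le> P k0 * \<mu>"
      unfolding W_def \<mu>_def using r A t P0 by (intro mult_left_mono sum_level_weight_le) auto
    also have "\<dots> \<le> (\<mu> * D) * \<mu>"
      using Pk0 \<mu> by (intro mult_right_mono) auto
    finally show ?thesis by (simp add: power2_eq_square mult_ac)
  qed (use D0 in auto)
  have "average_excess r t m n A = (\<Sum>k\<in>{1..m}. P k * W k)"
    by (simp add: average_excess_def P_def W_def)
  also have "\<dots> \<le> (\<Sum>k\<in>{1..min m (k0 - 1)} \<union> {k0..m}. P k * W k)"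
    using P0 W0 by (intro sum_mono2) auto
  also have "\<dots> = (\<Sum>k\<in>{1..min m (k0 - 1)}. P k * W k) + (\<Sum>k\<in>{k0..m}. P k * W k)"
    by (intro sum.union_disjoint) (auto simp: k0_def)
  also have "(\<Sum>k\<in>{1..min m (k0 - 1)}. P k * W k) \<le> (\<Sum>k\<in>{1..min m (k0 - 1)}. \<mu>\<^sup>2 * D ^ k)"
  proof (intro sum_mono small)
    fix k assume "k \<in> {1..min m (k0 - 1)}"
    then have k: "0 < k" "k \<le> m" "k \<le> nat \<lfloor>R\<rfloor>" by (auto simp: k0_def)
    then show "0 < k" "k \<le> m" by auto
    show "real k \<le> R" using k R by linarith
  qed
  also have "\<dots> \<le> \<mu>\<^sup>2 * (2 * D)"
    unfolding sum_distrib_left[symmetric] using sum_power_le[OF D0 D] by (intro mult_left_mono) auto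
  finally show ?thesis
    using tail by (simp add: \<mu>_def algebra_simps)
qed

section \<open>Protocols\<close>

text \<open>The success probability for fixed coins of the protocol, with the hidden bit and
  \<open>w\<close> averaged out: the YES case is answered correctly with probability 0 or 1, the NO
  case with one minus the accepted fraction of \<open>w\<close>.\<close>

definition det_success ::
  "det_protocol \<Rightarrow> nat \<Rightarrow> nat \<Rightarrow> nat set list \<Rightarrow> (nat \<Rightarrow> nat) \<Rightarrow> real" where
  "det_success = (\<lambda>(alice, bob) r n M x.
     (1 + of_bool (bob (alice x) M (mult_vec r n M x))
        - card {w \<in> Zr_vec r (length M). bob (alice x) M w} / r ^ length M) / 2)"

lemma det_success_bounds: "0 < r \<Longrightarrow> \<bar>det_success p r n M x\<bar> \<le> 1"
proof -
  assume r: "0 < r"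
  obtain alice bob where p: "p = (alice, bob)" by (cases p)
  let ?W = "Zr_vec r (length M)"
  have "card {w \<in> ?W. bob (alice x) M w} \<le> card ?W"
    by (intro card_mono) (auto simp: Zr_vec_def finite_vecs)
  also have "\<dots> = r ^ length M" by (simp add: Zr_vec_def card_vecs)
  finally have le: "card {w \<in> ?W. bob (alice x) M w} \<le> r ^ length M" .
  define q where "q = card {w \<in> ?W. bob (alice x) M w} / real r ^ length M"
  have "0 \<le> q" "q \<le> 1"
    using r le by (simp_all add: q_def divide_le_eq flip: of_nat_power)
  moreover have "det_success p r n M x = (1 + of_bool (bob (alice x) M (mult_vec r n M x)) - q) / 2"
    by (simp add: p det_success_def q_def)
  ultimately show ?thesis
    by (cases "bob (alice x) M (mult_vec r n M x)") (simp_all add: abs_le_iff)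
qed

lemma success_prob_eq:
  assumes "0 < r"
  shows "success_prob P r n M x = measure_pmf.expectation P (\<lambda>p. det_success p r n M x)"
proof -
  let ?W = "Zr_vec r (length M)"
  have W: "finite ?W" "?W \<noteq> {}" "card ?W = r ^ length M"
    using assms by (auto simp: Zr_vec_def finite_vecs card_vecs PiE_eq_empty_iff)
  have no: "pmf (bind_pmf (no_dist r M) (\<lambda>w. return_pmf (Q w = False))) True
      = 1 - card {w \<in> ?W. Q w} / r ^ length M" for Q
  proof -
    have "pmf (bind_pmf (no_dist r M) (\<lambda>w. return_pmf (Q w = False))) True
       = measure_pmf.prob (pmf_of_set ?W) {w. \<not> Q w}"
      unfolding map_pmf_def[symmetric] no_dist_def pmf_map by (simp add: vimage_def)
    also have "\<dots> = card (?W - {w \<in> ?W. Q w}) / card ?W"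
      using W by (simp add: measure_pmf_of_set) (auto intro!: arg_cong[where f = card])
    also have "card (?W - {w \<in> ?W. Q w}) = card ?W - card {w \<in> ?W. Q w}"
      using W by (intro card_Diff_subset) auto
    also have "real (card ?W - card {w \<in> ?W. Q w}) / card ?W = 1 - card {w \<in> ?W. Q w} / r ^ length M"
    proof -
      have "card {w \<in> ?W. Q w} \<le> card ?W" using W(1) by (intro card_mono) auto
      then show ?thesis using W assms by (simp add: of_nat_diff diff_divide_distrib)
    qed
    finally show ?thesis .
  qed
  have yes: "pmf (bind_pmf (yes_dist r n M x) (\<lambda>w. return_pmf (Q w = True))) True
      = of_bool (Q (mult_vec r n M x))" for Q
    by (simp add: yes_dist_def bind_return_pmf)
  have det: "pmf (case p of (alice, bob) \<Rightarrow>
        bind_pmf (bernoulli_pmf (1/2)) (\<lambda>b.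
          bind_pmf (if b then yes_dist r n M x else no_dist r M) (\<lambda>w.
            return_pmf (bob (alice x) M w = b)))) True = det_success p r n M x" for p
  proof -
    obtain alice bob where p: "p = (alice, bob)" by (cases p)
    show ?thesis
      unfolding p prod.case pmf_bind[of "bernoulli_pmf (1/2)"] 
      using no[of "bob (alice x) M"] yes[of "bob (alice x) M"]
      by (simp add: det_success_def add_divide_distrib diff_divide_distrib)
  qed
  show ?thesis
    unfolding success_prob_def measure_pmf_single pmf_bind[of P] det ..
qed

lemma card_bool_lists_le:
  assumes "\<And>l. l \<in> L \<Longrightarrow> length l \<le> C"
  shows "card (L :: bool list set) \<le> 2 ^ Suc C"
proof -
  let ?T = "{l :: bool list. set l \<subseteq> UNIV \<and> length l \<le> C}"
  have "card L \<le> card ?T"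
    using assms by (intro card_mono finite_lists_length_le) auto
  also have "\<dots> = (\<Sum>i\<le>C. 2 ^ i)"
    using card_lists_length_le[of "UNIV :: bool set" C] by simp
  also have "\<dots> \<le> 2 ^ Suc C"
    by (induction C) auto
  finally show ?thesis .
qed

text \<open>Success is 1/2 plus half the acceptance gap, and \<open>13/16 = (1 + 5/8) / 2\<close>.
  The 1 comes from the light messages, at most \<open>2 ^ Suc C\<close> of them with density below
  \<open>\<epsilon> / 2 ^ Suc C\<close> each. The 5/8 comes from the heavy ones:
  \<open>mult_vec_bias\<close> with \<eta> = \<epsilon>/2 gives 1/4 directly and 3/8 through the
  average excess.\<close>

lemma det_protocol_gap:
  fixes alice :: "(nat \<Rightarrow> nat) \<Rightarrow> bool list" and \<epsilon> :: real
  defines "A \<equiv> \<lambda>n r \<tau>. {x \<in> Zr_vec r n. alice x = \<tau>}"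
  assumes r: "0 < r" and t: "0 < t" and tm: "t * m \<le> n" and \<epsilon>: "0 < \<epsilon>"
    and len: "\<And>x. x \<in> Zr_vec r n \<Longrightarrow> length (alice x) \<le> C"
    and heavy: "\<And>\<tau>. A n r \<tau> \<noteq> {} \<Longrightarrow> \<epsilon> / 2 ^ Suc C \<le> rel_size r {..<n} (A n r \<tau>) \<Longrightarrow>
       average_excess r t m n (A n r \<tau>) \<le> 3 / 8 * \<epsilon>\<^sup>2 * (rel_size r {..<n} (A n r \<tau>))\<^sup>2"
  shows "(\<Sum>\<pi> | \<pi> permutes {..<n}. \<Sum>x\<in>Zr_vec r n. det_success (alice, bob) r n (blocks t m \<pi>) x)
     \<le> fact n * real r ^ n * (1 / 2 + 13 / 16 * \<epsilon>)"
proof -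
  let ?Z = "Zr_vec r n" and ?Pi = "{\<pi>. \<pi> permutes {..<n}}"
  define S where "S = A n r"
  define B where "B = (\<lambda>\<tau> \<pi>. {w \<in> Zr_vec r m. bob \<tau> (blocks t m \<pi>) w})"
  \<comment> \<open>Bob's acceptance gap on the class of one message, as a count: the inputs
    accepted under YES minus the expected number accepted under NO.\<close>
  define G where "G = (\<lambda>\<tau> \<pi>. card {x \<in> S \<tau>. mult_vec r n (blocks t m \<pi>) x \<in> B \<tau> \<pi>}
      - card (S \<tau>) * (card (B \<tau> \<pi>) / r ^ m))"
  have finZ: "finite ?Z" "card ?Z = r ^ n" by (simp_all add: Zr_vec_def finite_vecs card_vecs)
  have cardPi: "card ?Pi = fact n" using card_permutations[of "{..<n}" n] by simp
  have SZ: "S \<tau> \<subseteq> ?Z" "finite (S \<tau>)" for \<tau>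
    using finZ by (auto simp: S_def A_def)
  have G: "(\<Sum>\<pi>\<in>?Pi. G \<tau> \<pi>) \<le> fact n * (\<epsilon> * r ^ n / 2 ^ Suc C + 5 / 8 * \<epsilon> * card (S \<tau>))" for \<tau>
  proof (cases "rel_size r {..<n} (S \<tau>) < \<epsilon> / 2 ^ Suc C \<or> S \<tau> = {}")
    case True
    have "G \<tau> \<pi> \<le> \<epsilon> * r ^ n / 2 ^ Suc C + 5 / 8 * \<epsilon> * card (S \<tau>)" for \<pi>
    proof -
      have "card {x \<in> S \<tau>. mult_vec r n (blocks t m \<pi>) x \<in> B \<tau> \<pi>} \<le> card (S \<tau>)"
        using SZ by (intro card_mono) auto
      then have "G \<tau> \<pi> \<le> card (S \<tau>)"
        unfolding G_def by (smt (verit) divide_nonneg_nonneg mult_nonneg_nonneg of_nat_0_le_iff of_nat_mono zero_le_power)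
      also have "\<dots> \<le> \<epsilon> * r ^ n / 2 ^ Suc C"
        using True r \<epsilon> by (auto simp: rel_size_def field_simps)
      also have "\<dots> \<le> \<epsilon> * r ^ n / 2 ^ Suc C + 5 / 8 * \<epsilon> * card (S \<tau>)"
        using \<epsilon> by simp
      finally show ?thesis .
    qed
    then have "(\<Sum>\<pi>\<in>?Pi. G \<tau> \<pi>) \<le> (\<Sum>\<pi>\<in>?Pi. \<epsilon> * r ^ n / 2 ^ Suc C + 5 / 8 * \<epsilon> * card (S \<tau>))"
      by (intro sum_mono)
    then show ?thesis by (simp add: cardPi)
  next
    case False
    define \<mu> where "\<mu> = rel_size r {..<n} (S \<tau>)"
    have "0 < \<epsilon> / 2 ^ Suc C" using \<epsilon> by simp
    with False have \<mu>: "0 < \<mu>" by (simp add: \<mu>_def)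
    have avg: "average_excess r t m n (S \<tau>) \<le> 3 / 8 * \<epsilon>\<^sup>2 * \<mu>\<^sup>2"
      using heavy[of \<tau>] False by (simp add: S_def \<mu>_def)
    have "(\<Sum>\<pi>\<in>?Pi. G \<tau> \<pi>)
      \<le> (\<Sum>\<pi>\<in>?Pi. card (S \<tau>) * ((\<epsilon> / 2) / 2 + excess r n (S \<tau>) (blocks t m \<pi>) / (2 * (\<epsilon> / 2) * \<mu>\<^sup>2)))"
    proof (intro sum_mono)
      fix \<pi>
      show "G \<tau> \<pi> \<le> card (S \<tau>) * ((\<epsilon> / 2) / 2 + excess r n (S \<tau>) (blocks t m \<pi>) / (2 * (\<epsilon> / 2) * \<mu>\<^sup>2))"
        unfolding G_def \<mu>_def
        using mult_vec_bias[OF r SZ(1), of \<tau> "B \<tau> \<pi>" "blocks t m \<pi>" "\<epsilon> / 2"] False \<epsilon>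
        by (simp add: B_def)
    qed
    also have "\<dots> = card (S \<tau>) * (fact n * (\<epsilon> / 4)
        + (\<Sum>\<pi>\<in>?Pi. excess r n (S \<tau>) (blocks t m \<pi>)) / (\<epsilon> * \<mu>\<^sup>2))"
      by (simp add: sum_distrib_left[symmetric] sum.distrib sum_divide_distrib[symmetric] cardPi)
    also have "\<dots> \<le> card (S \<tau>) * (fact n * (\<epsilon> / 4) + (fact n * (3 / 8 * \<epsilon>\<^sup>2 * \<mu>\<^sup>2)) / (\<epsilon> * \<mu>\<^sup>2))"
    proof -
      have "(\<Sum>\<pi>\<in>?Pi. excess r n (S \<tau>) (blocks t m \<pi>)) \<le> fact n * average_excess r t m n (S \<tau>)"
        by (intro sum_excess_blocks tm t r)
      also have "\<dots> \<le> fact n * (3 / 8 * \<epsilon>\<^sup>2 * \<mu>\<^sup>2)"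
        using avg by (intro mult_left_mono) auto
      finally show ?thesis
        using \<epsilon> by (intro mult_left_mono add_left_mono divide_right_mono) auto
    qed
    also have "\<dots> = fact n * (5 / 8 * \<epsilon> * card (S \<tau>))"
      using \<epsilon> \<mu> by (simp add: field_simps power2_eq_square)
    also have "\<dots> \<le> fact n * (\<epsilon> * r ^ n / 2 ^ Suc C + 5 / 8 * \<epsilon> * card (S \<tau>))"
      using \<epsilon> by (intro mult_left_mono) auto
    finally show ?thesis .
  qed
  have group: "(\<Sum>x\<in>?Z. h x) = (\<Sum>\<tau>\<in>alice ` ?Z. \<Sum>x\<in>S \<tau>. h x)" for h :: "(nat \<Rightarrow> nat) \<Rightarrow> real"
    unfolding S_def A_def using finZ by (intro sum.group[symmetric]) auto
  have "(\<Sum>x\<in>?Z. 2 * det_success (alice, bob) r n (blocks t m \<pi>) x)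
     = real r ^ n + (\<Sum>\<tau>\<in>alice ` ?Z. G \<tau> \<pi>)" for \<pi>
  proof -
    let ?M = "blocks t m \<pi>"
    have eq: "2 * det_success (alice, bob) r n ?M x
        = 1 + ((if mult_vec r n ?M x \<in> B (alice x) \<pi> then 1 else 0) - card (B (alice x) \<pi>) / r ^ m)" for x
      using mult_vec_in[OF r, of n ?M x] by (simp add: det_success_def B_def)
    have inner: "(\<Sum>x\<in>S \<tau>. (if mult_vec r n ?M x \<in> B (alice x) \<pi> then 1 else 0) - card (B (alice x) \<pi>) / r ^ m)
       = G \<tau> \<pi>" for \<tau>
    proof -
      have "(\<Sum>x\<in>S \<tau>. (if mult_vec r n ?M x \<in> B (alice x) \<pi> then 1 else 0) - card (B (alice x) \<pi>) / r ^ m)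
         = (\<Sum>x\<in>S \<tau>. (if mult_vec r n ?M x \<in> B \<tau> \<pi> then 1 else 0) - card (B \<tau> \<pi>) / r ^ m)"
        by (intro sum.cong) (auto simp: S_def A_def)
      then show ?thesis
        using SZ(2)[of \<tau>] by (simp add: G_def sum_subtractf sum.If_cases Int_def)
    qed
    show ?thesis
      unfolding eq sum.distrib using group inner finZ by simp
  qed
  then have "(\<Sum>\<pi>\<in>?Pi. \<Sum>x\<in>?Z. 2 * det_success (alice, bob) r n (blocks t m \<pi>) x)
     = fact n * real r ^ n + (\<Sum>\<tau>\<in>alice ` ?Z. \<Sum>\<pi>\<in>?Pi. G \<tau> \<pi>)"
    by (simp add: sum.distrib cardPi sum.swap[of _ ?Pi])
  also have "(\<Sum>\<tau>\<in>alice ` ?Z. \<Sum>\<pi>\<in>?Pi. G \<tau> \<pi>)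
     \<le> (\<Sum>\<tau>\<in>alice ` ?Z. fact n * (\<epsilon> * r ^ n / 2 ^ Suc C + 5 / 8 * \<epsilon> * card (S \<tau>)))"
    by (intro sum_mono G)
  also have "\<dots> = fact n * (card (alice ` ?Z) * (\<epsilon> * r ^ n / 2 ^ Suc C) + 5 / 8 * \<epsilon> * (\<Sum>\<tau>\<in>alice ` ?Z. card (S \<tau>)))"
    by (simp only: sum_distrib_left[symmetric] sum.distrib sum_constant of_nat_sum)
  also have "(\<Sum>\<tau>\<in>alice ` ?Z. card (S \<tau>)) = r ^ n"
  proof -
    have "real (\<Sum>\<tau>\<in>alice ` ?Z. card (S \<tau>)) = real (r ^ n)"
      using group[of "\<lambda>_. 1"] finZ by simp
    then show ?thesis by (simp only: of_nat_eq_iff)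
  qed
  also have "card (alice ` ?Z) * (\<epsilon> * r ^ n / 2 ^ Suc C) \<le> 2 ^ Suc C * (\<epsilon> * r ^ n / 2 ^ Suc C)"
  proof (intro mult_right_mono)
    have "card (alice ` ?Z) \<le> 2 ^ Suc C"
      using len by (intro card_bool_lists_le) auto
    then have "real (card (alice ` ?Z)) \<le> real (2 ^ Suc C)" by (simp only: of_nat_le_iff)
    then show "real (card (alice ` ?Z)) \<le> 2 ^ Suc C" by simp
  qed (use \<epsilon> in auto)
  finally show ?thesis
    by (simp add: sum_distrib_left[symmetric] algebra_simps)
qed

text \<open>The easy half of Yao's principle: the guarantee for every input is averaged over
  \<open>x\<close> and \<pi>, and the finite sums are exchanged with the expectation over the coins,
  which leaves a bound on deterministic protocols.\<close>

lemma advantage_le_gap: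
  assumes r: "0 < r" and t: "0 < t" and tm: "t * m \<le> n" and m: "real m = \<alpha> * real n / real t"
    and adv: "achieves_advantage P r \<alpha> t n \<epsilon>"
    and det: "\<And>p. p \<in> set_pmf P \<Longrightarrow>
      (\<Sum>\<pi> | \<pi> permutes {..<n}. \<Sum>x\<in>Zr_vec r n. det_success p r n (blocks t m \<pi>) x)
        \<le> fact n * real r ^ n * (1 / 2 + \<beta>)"
  shows "\<epsilon> \<le> \<beta>"
proof -
  let ?Z = "Zr_vec r n" and ?Pi = "{\<pi>. \<pi> permutes {..<n}}"
  have card: "card ?Z = r ^ n" "card ?Pi = fact n"
    using card_permutations[of "{..<n}" n] by (simp_all add: Zr_vec_def card_vecs)
  have int: "integrable (measure_pmf P) (\<lambda>p. det_success p r n M x)" for M x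
    by (rule measure_pmf.integrable_const_bound[where B = 1]) (auto simp: det_success_bounds[OF r])
  have "fact n * real r ^ n * (1 / 2 + \<epsilon>) = (\<Sum>\<pi>\<in>?Pi. \<Sum>x\<in>?Z. 1 / 2 + \<epsilon>)"
    by (simp add: card)
  also have "\<dots> \<le> (\<Sum>\<pi>\<in>?Pi. \<Sum>x\<in>?Z. success_prob P r n (blocks t m \<pi>) x)"
    using adv blocks_in_hypermatchings[OF _ tm t m]
    by (intro sum_mono) (auto simp: achieves_advantage_def)
  also have "\<dots> = measure_pmf.expectation P (\<lambda>p. \<Sum>\<pi>\<in>?Pi. \<Sum>x\<in>?Z. det_success p r n (blocks t m \<pi>) x)"
    unfolding success_prob_eq[OF r] using int by (simp add: Bochner_Integration.integral_sum Bochner_Integration.integrable_sum)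
  also have "\<dots> \<le> measure_pmf.expectation P (\<lambda>_. fact n * real r ^ n * (1 / 2 + \<beta>))"
    using int det by (intro integral_mono_AE Bochner_Integration.integrable_sum) (auto simp: AE_measure_pmf_iff)
  finally show ?thesis
    using r by simp
qed

section \<open>Choice of parameters and the final bound\<close>

text \<open>This makes \<open>R = L / \<epsilon> powr (2 / t)\<close> admissible for every heavy
  message. With \<open>l = ln (1 / \<epsilon>)\<close>, the inequality
  \<open>1 + x \<le> exp x\<close> at \<open>x = 2 l / t\<close> gives
  \<open>t + 2 l \<le> t / \<epsilon> powr (2 / t)\<close>. Multiplied by
  \<open>L \<ge> C \<ge> 1\<close>, the left side is at least \<open>2 C + 2 l\<close>, hence at
  least \<open>(C + 1) ln 2 + l\<close>.\<close>

lemma log_size_bound: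
  fixes t r C :: nat and \<epsilon> L :: real
  assumes t: "2 \<le> t" and \<epsilon>: "0 < \<epsilon>" "\<epsilon> \<le> 1" and C: "1 \<le> C" "C \<le> L"
  shows "exp (- (t * (L / \<epsilon> powr (2 / t)))) \<le> \<epsilon> / 2 ^ Suc C"
proof -
  define \<l> where "\<l> = - ln \<epsilon>"
  have \<l>: "0 \<le> \<l>" using \<epsilon> by (simp add: \<l>_def)
  have "t + 2 * \<l> = t * (1 + 2 / t * \<l>)" using t by (simp add: field_simps)
  also have "\<dots> \<le> t * exp (2 / t * \<l>)"
    by (intro mult_left_mono exp_ge_add_one_self) auto
  also have "\<dots> = t / \<epsilon> powr (2 / t)"
    using \<epsilon> by (simp add: powr_def \<l>_def exp_minus field_simps)
  finally have "L * (t + 2 * \<l>) \<le> L * (t / \<epsilon> powr (2 / t))"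
    using C by (intro mult_left_mono) auto
  moreover have "real C * t + 1 * (2 * \<l>) \<le> L * t + L * (2 * \<l>)"
    using C \<l> by (intro add_mono mult_right_mono) auto
  moreover have "real C * 2 \<le> real C * t"
    using t by (intro mult_left_mono) auto
  ultimately have "real C * 2 + 2 * \<l> \<le> t * (L / \<epsilon> powr (2 / t))"
    by (simp add: algebra_simps)
  moreover have "Suc C * ln 2 \<le> Suc C * (1 :: real)"
    using ln_le_minus_one[of 2] by (intro mult_left_mono) auto
  moreover have "Suc C * (1 :: real) \<le> real C * 2"
    using C by simp
  ultimately have "Suc C * ln 2 + \<l> \<le> t * (L / \<epsilon> powr (2 / t))"
    using \<l> by linarith
  then have "exp (- (t * (L / \<epsilon> powr (2 / t)))) \<le> exp (- (Suc C * ln 2) - \<l>)"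
    by simp
  also have "\<dots> = \<epsilon> / 2 ^ Suc C"
  proof -
    have "exp (Suc C * ln 2) = (2 :: real) ^ Suc C"
      by (subst exp_of_nat_mult) simp
    then show ?thesis
      using \<epsilon> by (simp add: exp_diff exp_minus \<l>_def field_simps del: power_Suc)
  qed
  finally show ?thesis .
qed

text \<open>As \<open>m\<close> is \<alpha> times \<open>N\<close>, the \<open>t\<close>-th power of
  the threshold divided by \<open>N\<close> is \<open>\<epsilon>^2 / m\<close>. This shape of the
  threshold is what reduces \<open>D\<close> in \<open>average_excess_le\<close> to a constant to
  the power \<open>t\<close> times \<epsilon>^2.\<close>

lemma threshold_power:
  fixes m n t :: nat and \<alpha> \<epsilon> b :: real
  defines "N \<equiv> n / t"
  assumes t: "0 < t" and n: "0 < n" and \<alpha>: "0 < \<alpha>" and m: "real m = \<alpha> * N" and \<epsilon>: "0 < \<epsilon>"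
  shows "m * (b * ((\<epsilon>\<^sup>2 / \<alpha>) powr (1 / t) * N powr (1 - 1 / t)) / N) ^ t = b ^ t * \<epsilon>\<^sup>2"
proof -
  have N: "0 < N" using t n by (simp add: N_def)
  have "((\<epsilon>\<^sup>2 / \<alpha>) powr (1 / t)) ^ t = \<epsilon>\<^sup>2 / \<alpha>"
    using t \<alpha> \<epsilon> by (simp add: powr_power)
  moreover have "(N powr (1 - 1 / t)) ^ t = N ^ t / N"
  proof -
    have "(N powr (1 - 1 / t)) ^ t = N powr ((1 - 1 / t) * t)"
      using N by (simp add: powr_power mult.commute)
    also have "(1 - 1 / t) * t = real t - 1"
      using t by (simp add: field_simps)
    also have "N powr (real t - 1) = N ^ t / N"
      using N by (simp add: powr_diff powr_realpow)
    finally show ?thesis .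
  qed
  ultimately show ?thesis
    using N \<alpha> by (simp add: m power_divide power_mult_distrib)
qed

theorem theorem4p8:
  "\<exists>c::real. c > 0 \<and>
     (\<forall>(r::nat) (t::nat) (n::nat) (\<alpha>::real) (\<epsilon>::real) (P::protocol) (C::nat).
        r \<ge> 2 \<longrightarrow> t \<ge> 2 \<longrightarrow> t dvd n \<longrightarrow> 0 < \<alpha> \<longrightarrow> \<alpha> \<le> 1/2 \<longrightarrow>
        \<alpha> * real n / real t \<in> \<int> \<longrightarrow> \<epsilon> > 0 \<longrightarrow>
        achieves_advantage P r \<alpha> t n \<epsilon> \<longrightarrow>
        comm_at_most P r n C \<longrightarrow>
        real C \<ge> c * (1 / real r * (\<epsilon> ^ 4 / \<alpha>) powr (1 / real t)
                        * (real n / real t) powr (1 - 1 / real t)))"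
\<comment> \<open>The constant 1/60 turns the factor \<open>2 * exp 2\<close> of \<open>D\<close>
  into \<open>exp 2 / 30 \<le> 3/10\<close>, whose square is below 1/8; with
  \<open>t \<ge> 2\<close> the average excess then meets the 3/8 required by
  \<open>det_protocol_gap\<close>.\<close>
proof (intro exI[of _ "1 / 60"] conjI allI impI)
  fix r t n :: nat and \<alpha> \<epsilon> :: real and P :: protocol and C :: nat
  assume r2: "2 \<le> r" and t2: "2 \<le> t" and "t dvd n" and \<alpha>: "0 < \<alpha>" "\<alpha> \<le> 1/2"
    and int: "\<alpha> * real n / real t \<in> \<int>" and \<epsilon>: "0 < \<epsilon>"
    and adv: "achieves_advantage P r \<alpha> t n \<epsilon>" and comm: "comm_at_most P r n C"
  define N where "N = real n / real t"
  define L where "L = 1 / 60 * (1 / real r * (\<epsilon> ^ 4 / \<alpha>) powr (1 / real t) * N powr (1 - 1 / real t))"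
  have r: "0 < r" and t: "0 < t" using r2 t2 by auto
  have "L \<le> C"
  \<comment> \<open>For \<open>n = 0\<close> the claimed bound is 0, because
    \<open>0 powr a = 0\<close>.\<close>
  proof (cases "n = 0")
    case True
    then show ?thesis by (simp add: L_def N_def)
  next
    case False
    then have n: "0 < n" by simp
    have N: "0 < N" using n t by (simp add: N_def)
    have "0 < \<alpha> * real n / real t" using \<alpha> n t by simp
    with int obtain m :: nat where m: "real m = \<alpha> * real n / real t"
      by (metis Ints_cases less_imp_le of_int_0_le_iff of_int_of_nat_eq zero_le_imp_eq_int)
    have m0: "0 < m" using m \<open>0 < \<alpha> * real n / real t\<close> by (metis of_nat_0_less_iff)
    have "2 * (real t * real m) = 2 * \<alpha> * n" using m t by simp
    also have "\<dots> \<le> 1 * real n" using \<alpha> by (intro mult_right_mono) auto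
    finally have "real (2 * (t * m)) \<le> real n" by simp
    then have tm2: "2 * (t * m) \<le> n" by (simp only: of_nat_le_iff)
    then have tm: "t * m \<le> n" by simp
    \<comment> \<open>One admissible input suffices, since a success probability is at most 1. The
      bound makes \<open>ln (1 / \<epsilon>)\<close> nonnegative and \<open>L \<le> L / e\<close>
      below.\<close>
    have "\<epsilon> \<le> 1"
    proof -
      have "blocks t m id \<in> hypermatchings \<alpha> t n"
        by (rule blocks_in_hypermatchings[OF permutes_id tm t m])
      moreover have "(\<lambda>i\<in>{..<n}. 0) \<in> Zr_vec r n" using r by (auto simp: Zr_vec_def)
      ultimately have "1 / 2 + \<epsilon> \<le> success_prob P r n (blocks t m id) (\<lambda>i\<in>{..<n}. 0)"
        using adv by (auto simp: achieves_advantage_def)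
      also have "\<dots> \<le> 1" by (simp add: success_prob_def)
      finally show ?thesis by simp
    qed
    show ?thesis
    proof (rule ccontr)
      assume "\<not> L \<le> C"
      then have L: "C \<le> L" by simp
      have heavy: "average_excess r t m n {x \<in> Zr_vec r n. alice x = \<tau>}
            \<le> 3 / 8 * \<epsilon>\<^sup>2 * (rel_size r {..<n} {x \<in> Zr_vec r n. alice x = \<tau>})\<^sup>2"
        if len: "\<And>x. x \<in> Zr_vec r n \<Longrightarrow> length (alice x) \<le> C"
          and ne: "{x \<in> Zr_vec r n. alice x = \<tau>} \<noteq> {}"
          and \<mu>: "\<epsilon> / 2 ^ Suc C \<le> rel_size r {..<n} {x \<in> Zr_vec r n. alice x = \<tau>}"
        for alice \<tau>
      \<comment> \<open>Without communication \<open>L\<close> may be below 1, and then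
        \<open>R \<ge> 1\<close> cannot be obtained from \<open>C \<le> L\<close>. In this case
        every input sends the empty message, so a nonempty class is the whole space and its excess
        vanishes.\<close>
      proof (cases "C = 0")
        case True
        then have "{x \<in> Zr_vec r n. alice x = \<tau>} = Zr_vec r n"
          using len ne by auto
        then have "average_excess r t m n {x \<in> Zr_vec r n. alice x = \<tau>} \<le> 0"
          using average_excess_full[OF r t] by simp
        then show ?thesis
          by (rule order_trans) simp
      next
        case False
        define e where "e = \<epsilon> powr (2 / t)"
        define Y where "Y = (\<epsilon>\<^sup>2 / \<alpha>) powr (1 / t) * N powr (1 - 1 / t)"
        have e: "0 < e" "e \<le> 1"
          using \<epsilon> \<open>\<epsilon> \<le> 1\<close> powr_mono2[of "2 / t" \<epsilon> 1] by (auto simp: e_def)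
        \<comment> \<open>Here the fourth power is divided up: one \<epsilon>^2 becomes
          \<open>e\<close> and pays for \<open>ln (1 / \<epsilon>)\<close>, the other stays in
          \<open>Y\<close> and becomes the \<epsilon>^2 of the excess bound.\<close>
        have "\<epsilon> ^ 4 / \<alpha> = \<epsilon> powr 2 * (\<epsilon>\<^sup>2 / \<alpha>)"
          using \<epsilon> by (simp add: power_add[symmetric])
        then have "(\<epsilon> ^ 4 / \<alpha>) powr (1 / t) = e * (\<epsilon>\<^sup>2 / \<alpha>) powr (1 / t)"
          using \<epsilon> \<alpha> by (simp only: e_def powr_mult powr_powr) simp
        then have Le: "L / e = Y / (60 * r)"
          using e by (simp add: L_def Y_def)
        have "L \<le> L / e"
          using e L by (simp add: le_divide_eq mult_left_le)
        then have R: "1 \<le> L / e"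
          using L False by linarith
        have size: "exp (- (t * (L / e))) \<le> rel_size r {..<n} {x \<in> Zr_vec r n. alice x = \<tau>}"
          using log_size_bound[OF t2 \<epsilon> \<open>\<epsilon> \<le> 1\<close> _ L] False \<mu> unfolding e_def by simp
        define D where "D = m * (2 * exp 2 * r * (L / e) * t / n) ^ t"
        have "2 * exp 2 * r * (L / e) * t / n = exp 2 / 30 * Y / N"
          using r by (simp add: Le N_def)
        then have "D = (exp 2 / 30) ^ t * \<epsilon>\<^sup>2"
          unfolding D_def Y_def N_def using threshold_power[of t n \<alpha> m \<epsilon> "exp 2 / 30"] t n \<alpha> m \<epsilon> by simp
        also have "\<dots> \<le> 1 / 8 * \<epsilon>\<^sup>2"
        proof (intro mult_right_mono)
          have "exp (1 :: real) * exp 1 \<le> 3 * 3"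
            by (intro mult_mono exp_le) auto
          then have exp2: "exp (2 :: real) / 30 \<le> 3 / 10"
            by (simp add: exp_add[symmetric])
          have "(exp (2 :: real) / 30) ^ t \<le> (exp 2 / 30) ^ 2"
            using exp2 t2 by (intro power_decreasing) auto
          also have "\<dots> \<le> (3 / 10) ^ 2"
            using exp2 by (intro power_mono) auto
          finally show "(exp (2 :: real) / 30) ^ t \<le> 1 / 8"
            by (simp add: power2_eq_square)
        qed auto
        finally have D: "D \<le> 1 / 8 * \<epsilon>\<^sup>2" .
        have "\<epsilon>\<^sup>2 \<le> 1" using \<epsilon> \<open>\<epsilon> \<le> 1\<close> by (simp add: power_le_one)
        then have "D \<le> 1 / 2" using D by simp
        then have "average_excess r t m n {x \<in> Zr_vec r n. alice x = \<tau>}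
          \<le> 3 * D * (rel_size r {..<n} {x \<in> Zr_vec r n. alice x = \<tau>})\<^sup>2"
          unfolding D_def by (intro average_excess_le t r m0 tm2 ne R size) auto
        also have "\<dots> \<le> 3 / 8 * \<epsilon>\<^sup>2 * (rel_size r {..<n} {x \<in> Zr_vec r n. alice x = \<tau>})\<^sup>2"
          using D by (intro mult_right_mono) auto
        finally show ?thesis .
      qed
      have "\<epsilon> \<le> 13 / 16 * \<epsilon>"
      proof (rule advantage_le_gap[OF r t tm m adv])
        fix p assume p: "p \<in> set_pmf P"
        obtain alice bob where eq: "p = (alice, bob)" by (cases p)
        have len: "length (alice x) \<le> C" if "x \<in> Zr_vec r n" for x
          using comm p that unfolding comm_at_most_def eq by fast
        show "(\<Sum>\<pi> | \<pi> permutes {..<n}. \<Sum>x\<in>Zr_vec r n. det_success p r n (blocks t m \<pi>) x)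
            \<le> fact n * real r ^ n * (1 / 2 + 13 / 16 * \<epsilon>)"
          unfolding eq by (rule det_protocol_gap[OF r t tm \<epsilon> len heavy[OF len]])
      qed
      then show False using \<epsilon> by simp
    qed
  qed
  then show "1 / 60 * (1 / real r * (\<epsilon> ^ 4 / \<alpha>) powr (1 / real t) * (real n / real t) powr (1 - 1 / real t)) \<le> real C"
    by (simp add: L_def N_def)
qed simp

end
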